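(* Let $m\ge r\ge 1$ be integers and let $P$ be an $m\times m$ (Hermitian) positive definite complex matrix. Assume that an $m\times r$ random complex matrix $Z$ has a density of the form $$f_Z(Z)=|P|^{-r}g(\bar Z'P^{-1}Z)$$ for some function $g$, and that this density is invariant under right unitary transformations, i.e. $f_Z(ZQ)=f_Z(Z)$ for every $Q\in\mathbb{C}^{r\times r}$ with $\bar Q'Q=I_r$. Then the orientation $H_Z$ of $Z$ has the $CMACG(P)$ distribution.
   Context: $\bar X'$ denotes the conjugate transpose of a complex matrix $X$ and $|\cdot|$ the determinant. Densities of random matrices in $\mathbb{C}^{m\times r}$ are with respect to Lebesgue measure on $\mathbb{C}^{m\times r}\cong\mathbb{R}^{2mr}$. The complex Stiefel manifold is $V_{r,m}^{\mathbb{C}}=\{X\in\mathbb{C}^{m\times r}:\bar X'X=I_r\}$. The normalized invariant measure on $V_{r,m}^{\mathbb{C}}$ is the unique Borel probability measure invariant under $X\mapsto UXQ$ for all unitary $U\in\mathbb{C}^{m\times m}$, $Q\in\mathbb{C}^{r\times r}$. For a matrix $Z\in\mathbb{C}^{m\times r}$ of full column rank (which holds almost surely for a random matrix with a density), its orientation is $H_Z=Z(\bar Z'Z)^{-1/2}\in V_{r,m}^{\mathbb{C}}$, where $(\bar Z'Z)^{-1/2}$ is the inverse of the Hermitian positive definite square root of $\bar Z'Z$. A random element of $V_{r,m}^{\mathbb{C}}$ has the $CMACG(P)$ distribution if it has density $H\mapsto|P|^{-r}|\bar H'P^{-1}H|^{-m}$ with respect to the normalized invariant measure on $V_{r,m}^{\mathbb{C}}$.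 *)

theory Defs
  imports "HOL-Probability.Probability"
begin

(* An m x r complex matrix is an element of complex^'r^'m with m = CARD('m), r = CARD('r).
   As a Euclidean space this type has the norm of R^(2mr), so lborel on it is the Lebesgue
   measure on C^(m x r). *)

definition conj_transpose :: "complex^'r^'m \<Rightarrow> complex^'m^'r" where
  "conj_transpose X = map_matrix cnj (transpose X)"

definition unitary_matrix :: "complex^'n^'n \<Rightarrow> bool" where
  "unitary_matrix U \<longleftrightarrow> conj_transpose U ** U = mat 1"

definition hermitian_pos_def :: "complex^'n^'n \<Rightarrow> bool" where
  "hermitian_pos_def A \<longleftrightarrow> conj_transpose A = A \<and>
     (\<forall>x. x \<noteq> 0 \<longrightarrow> 0 < Re (\<Sum>i\<in>UNIV. cnj (x $ i) * (A *v x) $ i))"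

(* Meaningful only for Hermitian positive definite A, where the root exists and is unique. *)
definition hpd_sqrt :: "complex^'n^'n \<Rightarrow> complex^'n^'n" where
  "hpd_sqrt A = (THE S. hermitian_pos_def S \<and> S ** S = A)"

definition stiefel :: "(complex^'r^'m) set" where
  "stiefel = {X. conj_transpose X ** X = mat 1}"

(* The normalized invariant measure; its space is the Stiefel manifold itself, with the Borel
   sets of the subspace topology. Meaningful only for CARD('r) <= CARD('m). *)
definition stiefel_measure :: "(complex^'r^'m) measure" where
  "stiefel_measure = (THE \<mu>. prob_space \<mu> \<and> sets \<mu> = sets (restrict_space borel stiefel) \<and>
     (\<forall>U Q. unitary_matrix U \<longrightarrow> unitary_matrix Q \<longrightarrow> distr \<mu> \<mu> (\<lambda>X. U ** X ** Q) = \<mu>))"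

(* Matrices without full column rank, which have Lebesgue measure 0, are sent to an arbitrary
   fixed point of the Stiefel manifold. This makes the orientation of a random matrix an
   everywhere defined random element of the manifold without changing its distribution. *)
definition orientation :: "complex^'r^'m \<Rightarrow> complex^'r^'m" where
  "orientation Z = (if rank Z = CARD('r)
     then Z ** matrix_inv (hpd_sqrt (conj_transpose Z ** Z))
     else (SOME X. X \<in> stiefel))"

(* For Hermitian positive definite P and H in the Stiefel manifold both determinants are
   positive reals, so Re loses nothing. *)
definition cmacg_density :: "complex^'m^'m \<Rightarrow> complex^'r^'m \<Rightarrow> real" where
  "cmacg_density P H =
     inverse (Re (det P) ^ CARD('r)) *
     inverse (Re (det (conj_transpose H ** matrix_inv P ** H)) ^ CARD('m))"

definition has_CMACG :: "'a measure \<Rightarrow> ('a \<Rightarrow> complex^'r^'m) \<Rightarrow> complex^'m^'m \<Rightarrow> bool" where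
  "has_CMACG M H P \<longleftrightarrow> distributed M stiefel_measure H (\<lambda>X. ennreal (cmacg_density P X))"

end

theory Submission
  imports Defs "HOL-Computational_Algebra.Polynomial"
begin

text \<open>
  Write \<open>z = H T\<close> for the polar decomposition of a matrix of full column rank, with \<open>H\<close> its
  orientation and \<open>T\<close> the Hermitian positive definite root of its Gram matrix, and let \<open>\<sigma>\<close> be the
  invariant probability measure on the Stiefel manifold.

  Lebesgue measure on the \<open>m \<times> r\<close> matrices is invariant under the unitary group acting from the
  left, and that group acts transitively on the Stiefel manifold.  Averaging over it therefore
  gives, for every nonnegative \<open>F\<close>,
  \<open>\<integral> F z dz = \<integral> \<integral> F (H T(z)) dz d\<sigma>(H)\<close>
  (lemma \<open>nn_integral_polar\<close>), which takes the place of the Jacobian of the polar decomposition.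
  Since \<open>H T\<close> has the orientation \<open>H\<close>, the density of the orientation of \<open>Z\<close> at \<open>H\<close> is
  \<open>\<integral> f (H T(z)) dz\<close>.

  To evaluate this integral, let \<open>B\<close> be the root of \<open>P\<close> and let \<open>X S\<close> be the polar decomposition
  of \<open>B\<^sup>-\<^sup>1 H\<close>, so that \<open>S\<^sup>2 = H\<^sup>\<dagger> P\<^sup>-\<^sup>1 H\<close>.  The density \<open>f\<close> sees its argument \<open>y\<close> only through
  \<open>y\<^sup>\<dagger> P\<^sup>-\<^sup>1 y\<close>.  This matrix is \<open>N\<^sup>\<dagger> N\<close> for \<open>y = H T\<close> and \<open>N N\<^sup>\<dagger>\<close> for \<open>y = B z S\<close>, where \<open>N = S T\<close>.
  The two are unitarily similar, so right invariance of \<open>f\<close> gives \<open>f (H T(z)) = f (B z S)\<close>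
  (lemma \<open>fiber_invariance\<close>).  The map \<open>z \<mapsto> B z S\<close> multiplies volumes by
  \<open>|B|\<^sup>2\<^sup>r |S|\<^sup>2\<^sup>m = |P|\<^sup>r |H\<^sup>\<dagger> P\<^sup>-\<^sup>1 H|\<^sup>m\<close>, and \<open>f\<close> has total integral one; hence the
  integral is the CMACG density (lemma \<open>nn_integral_fiber\<close>).

  The supporting theory is the spectral theorem for Hermitian matrices, from which come square
  roots, polar decompositions and the volume factors of positive definite matrices, and the
  existence and uniqueness of \<open>\<sigma>\<close>: the orientation of a uniformly random point of the unit ball
  has an invariant law, and averaging over the unitary group shows that there is no other.
\<close>

section \<open>The conjugate transpose and the Hermitian inner product\<close>

notation conj_transpose (\<open>_\<^sup>\<dagger>\<close> [1000] 1000)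

definition cinner :: "complex^'n \<Rightarrow> complex^'n \<Rightarrow> complex" where
  "cinner x y = (\<Sum>i\<in>UNIV. cnj (x $ i) * y $ i)"

definition real_diag :: "('n \<Rightarrow> real) \<Rightarrow> complex^'n^'n" where
  "real_diag d = (\<chi> i j. if i = j then complex_of_real (d i) else 0)"

lemma conj_transpose_nth [simp]: "X\<^sup>\<dagger> $ i $ j = cnj (X $ j $ i)"
  by (simp add: conj_transpose_def transpose_def)

lemma conj_transpose_mult: "(A ** B)\<^sup>\<dagger> = B\<^sup>\<dagger> ** A\<^sup>\<dagger>"
  by (simp add: vec_eq_iff matrix_matrix_mult_def mult.commute)

lemma conj_transpose_conj_transpose [simp]: "A\<^sup>\<dagger>\<^sup>\<dagger> = A"
  by (simp add: vec_eq_iff)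

lemma conj_transpose_one [simp]: "(mat 1 :: complex^'n^'n)\<^sup>\<dagger> = mat 1"
  by (auto simp: vec_eq_iff mat_def)

lemma conj_transpose_diff: "(A - B)\<^sup>\<dagger> = A\<^sup>\<dagger> - B\<^sup>\<dagger>"
  by (simp add: vec_eq_iff)

lemma conj_transpose_real_diag [simp]: "(real_diag d)\<^sup>\<dagger> = real_diag d"
  by (auto simp: vec_eq_iff real_diag_def)

lemma real_diag_mult_right: "(A ** real_diag d) $ i $ j = A $ i $ j * complex_of_real (d j)"
  by (simp add: matrix_matrix_mult_def real_diag_def if_distrib cong: if_cong)

lemma real_diag_mult_left: "(real_diag d ** A) $ i $ j = complex_of_real (d i) * A $ i $ j"
  by (simp add: matrix_matrix_mult_def real_diag_def if_distrib if_distribR cong: if_cong)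

lemma real_diag_mult_real_diag: "real_diag c ** real_diag d = real_diag (\<lambda>i. c i * d i)"
  unfolding vec_eq_iff real_diag_mult_left by (simp add: real_diag_def)

lemma det_real_diag: "det (real_diag d) = complex_of_real (\<Prod>i\<in>UNIV. d i)"
  by (subst det_diagonal) (auto simp: real_diag_def)

lemma real_diag_vector_mult: "(real_diag d *v x) $ i = complex_of_real (d i) * x $ i"
  by (simp add: matrix_vector_mult_def real_diag_def if_distrib if_distribR cong: if_cong)

lemma cinner_add_left: "cinner (x + y) z = cinner x z + cinner y z"
  and cinner_add_right: "cinner z (x + y) = cinner z x + cinner z y"
  and cinner_scale_left: "cinner (c *s x) z = cnj c * cinner x z"
  and cinner_scale_right: "cinner z (c *s x) = c * cinner z x"
  by (simp_all add: cinner_def algebra_simps sum.distrib sum_distrib_left)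

lemma cinner_zero [simp]: "cinner 0 x = 0" "cinner x 0 = 0"
  by (simp_all add: cinner_def)

lemma cinner_diff_left: "cinner (x - y) z = cinner x z - cinner y z"
  and cinner_diff_right: "cinner z (x - y) = cinner z x - cinner z y"
  by (simp_all add: cinner_def algebra_simps sum_subtractf)

lemma cnj_cinner: "cnj (cinner x y) = cinner y x"
  by (simp add: cinner_def mult.commute)

lemma cinner_adjoint: "cinner x (A *v y) = cinner (A\<^sup>\<dagger> *v x) y"
proof -
  have "cinner x (A *v y) = (\<Sum>i\<in>UNIV. \<Sum>j\<in>UNIV. cnj (x $ i) * A $ i $ j * y $ j)"
    by (simp add: cinner_def matrix_vector_mult_def sum_distrib_left mult.assoc)
  also have "\<dots> = (\<Sum>j\<in>UNIV. \<Sum>i\<in>UNIV. cnj (x $ i) * A $ i $ j * y $ j)"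
    by (rule sum.swap)
  also have "\<dots> = cinner (A\<^sup>\<dagger> *v x) y"
    by (simp add: cinner_def matrix_vector_mult_def sum_distrib_left sum_distrib_right mult_ac)
  finally show ?thesis .
qed

lemma cinner_self: "cinner x x = complex_of_real ((norm x)\<^sup>2)"
  by (simp add: cinner_def norm_vec_def L2_set_def sum_nonneg complex_norm_square mult.commute
      del: of_real_power)

lemma cinner_axis_left: "cinner (axis i 1) x = x $ i"
  by (simp add: cinner_def axis_def if_distrib if_distribR cong: if_cong)

lemma matrix_vector_axis: "(A *v axis j 1) $ i = (A $ i $ j :: complex)"
  by (simp add: matrix_vector_mult_def axis_def if_distrib cong: if_cong)

lemma hermitian_pos_def_iff:
  "hermitian_pos_def A \<longleftrightarrow> A\<^sup>\<dagger> = A \<and> (\<forall>x. x \<noteq> 0 \<longrightarrow> 0 < Re (cinner x (A *v x)))"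
  by (simp add: hermitian_pos_def_def cinner_def)

text \<open>
  Polarization: the values of the form on \<open>e\<^sub>i + c e\<^sub>j\<close> for \<open>c = 1\<close> and \<open>c = \<i>\<close> control the imaginary
  and the real part of \<open>B\<^sub>i\<^sub>j - cnj B\<^sub>j\<^sub>i\<close>.
\<close>

lemma hermitian_if_real_form:
  fixes B :: "complex^'n^'n"
  assumes "\<And>u. Im (cinner u (B *v u)) = 0"
  shows "B\<^sup>\<dagger> = B"
proof -
  have expand: "cinner (axis i 1 + c *s axis j 1) (B *v (axis i 1 + c *s axis j 1))
     = B $ i $ i + c * B $ i $ j + cnj c * B $ j $ i + cnj c * c * B $ j $ j" for i j c
    by (simp add: matrix_vector_right_distrib vec.scale cinner_add_left cinner_add_right
        cinner_scale_left cinner_scale_right cinner_axis_left matrix_vector_axis algebra_simps)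
  have diag: "Im (B $ i $ i) = 0" for i
    using assms[of "axis i 1"] by (simp add: cinner_axis_left matrix_vector_axis)
  have "cnj (B $ j $ i) = B $ i $ j" for i j
    using assms[of "axis i 1 + 1 *s axis j 1"] assms[of "axis i 1 + \<i> *s axis j 1"]
      diag[of i] diag[of j] unfolding expand
    by (auto simp: complex_eq_iff)
  then show ?thesis by (simp add: vec_eq_iff)
qed

lemma bounded_bilinear_matrix_mult:
  "bounded_bilinear ((**) :: complex^'b^'a \<Rightarrow> complex^'c^'b \<Rightarrow> complex^'c^'a)"
proof -
  have "bilinear ((**) :: complex^'b^'a \<Rightarrow> complex^'c^'b \<Rightarrow> complex^'c^'a)"
    unfolding bilinear_def linear_iff
    by (auto simp: vec_eq_iff matrix_matrix_mult_def algebra_simps sum.distrib scaleR_sum_right)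
  then show ?thesis by (simp add: bilinear_conv_bounded_bilinear)
qed

lemmas continuous_on_matrix_mult [continuous_intros] =
  bounded_bilinear.continuous_on[OF bounded_bilinear_matrix_mult]

lemma bounded_linear_conj_transpose:
  "bounded_linear (conj_transpose :: complex^'b^'a \<Rightarrow> complex^'a^'b)"
proof -
  have "linear (conj_transpose :: complex^'b^'a \<Rightarrow> complex^'a^'b)"
    by (auto simp: linear_iff vec_eq_iff)
  then show ?thesis by (simp add: linear_conv_bounded_linear)
qed

lemmas continuous_on_conj_transpose [continuous_intros] =
  bounded_linear.continuous_on[OF bounded_linear_conj_transpose]

lemma continuous_on_det [continuous_intros]:
  fixes f :: "'a::topological_space \<Rightarrow> complex^'n^'n"
  assumes "continuous_on S f"
  shows "continuous_on S (\<lambda>x. det (f x))"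
  unfolding det_def by (intro continuous_intros assms)

lemma sum_norm_entries:
  fixes z :: "complex^'r^'m"
  shows "(norm z)\<^sup>2 = (\<Sum>i\<in>UNIV. \<Sum>j\<in>UNIV. (cmod (z $ i $ j))\<^sup>2)"
  by (simp add: norm_vec_def L2_set_def sum_nonneg)

lemma norm_conv_trace:
  fixes z :: "complex^'r^'m"
  shows "(norm z)\<^sup>2 = Re (trace (z\<^sup>\<dagger> ** z))"
proof -
  have "Re (trace (z\<^sup>\<dagger> ** z)) = (\<Sum>j\<in>UNIV. \<Sum>i\<in>UNIV. (cmod (z $ i $ j))\<^sup>2)"
    by (simp add: trace_def matrix_matrix_mult_def cmod_power2 flip: power2_eq_square)
  also have "\<dots> = (norm z)\<^sup>2"
    unfolding sum_norm_entries by (rule sum.swap)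
  finally show ?thesis by simp
qed

lemma compact_stiefel: "compact (stiefel :: (complex^'r^'m) set)"
proof -
  have "closed (stiefel :: (complex^'r^'m) set)"
    unfolding stiefel_def by (intro closed_Collect_eq continuous_intros)
  moreover have "(norm X)\<^sup>2 = CARD('r)" if "X \<in> stiefel" for X :: "complex^'r^'m"
    using that by (simp add: norm_conv_trace stiefel_def trace_I)
  then have "norm X = sqrt CARD('r)" if "X \<in> stiefel" for X :: "complex^'r^'m"
    using that real_sqrt_unique by fastforce
  then have "bounded (stiefel :: (complex^'r^'m) set)"
    unfolding bounded_iff by (metis order_refl)
  ultimately show ?thesis by (simp add: compact_eq_bounded_closed)
qed

lemma unitary_matrix_iff_stiefel: "unitary_matrix U \<longleftrightarrow> U \<in> stiefel"
  by (simp add: unitary_matrix_def stiefel_def)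

lemma unitary_right_inverse: "unitary_matrix U \<Longrightarrow> U ** U\<^sup>\<dagger> = mat 1"
  unfolding unitary_matrix_def by (rule matrix_left_right_inverse1)

lemma unitary_conj_transpose: "unitary_matrix U \<Longrightarrow> unitary_matrix (U\<^sup>\<dagger>)"
  unfolding unitary_matrix_def[of "U\<^sup>\<dagger>"] by (simp add: unitary_right_inverse)

lemma unitary_one [simp]: "unitary_matrix (mat 1)"
  by (simp add: unitary_matrix_def)

lemma mult_cancel_stiefel: "X \<in> stiefel \<Longrightarrow> X\<^sup>\<dagger> ** (X ** A) = A"
  by (simp add: matrix_mul_assoc stiefel_def)

lemma gram_stiefel_mult:
  assumes "X \<in> stiefel"
  shows "(X ** A)\<^sup>\<dagger> ** (X ** A) = A\<^sup>\<dagger> ** A"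
proof -
  have "(X ** A)\<^sup>\<dagger> ** (X ** A) = A\<^sup>\<dagger> ** (X\<^sup>\<dagger> ** (X ** A))"
    by (simp only: conj_transpose_mult matrix_mul_assoc)
  then show ?thesis by (simp add: mult_cancel_stiefel[OF assms])
qed

lemma stiefel_mult:
  assumes "X \<in> stiefel" "Y \<in> stiefel"
  shows "X ** Y \<in> stiefel"
proof -
  have "(X ** Y)\<^sup>\<dagger> ** (X ** Y) = Y\<^sup>\<dagger> ** Y"
    by (rule gram_stiefel_mult[OF assms(1)])
  with assms(2) show ?thesis by (simp add: stiefel_def)
qed

lemma matrix_diff_left: "(A - B) ** C = A ** C - B ** (C :: complex^'c^'b)"
  and matrix_diff_right: "D ** (E - F) = D ** E - D ** (F :: complex^'c^'b)"
  using bounded_bilinear.diff_left[OF bounded_bilinear_matrix_mult]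
    bounded_bilinear.diff_right[OF bounded_bilinear_matrix_mult] by auto

section \<open>The spectral theorem\<close>

lemma exists_inj_real: "\<exists>d :: 'n::finite \<Rightarrow> real. inj d"
proof -
  obtain f :: "'n \<Rightarrow> nat" where "inj f"
    using finite_imp_inj_to_nat_seg[of "UNIV :: 'n set"] by auto
  then have "inj (\<lambda>i. real (f i))" by (auto simp: inj_def)
  then show ?thesis by blast
qed

text \<open>
  The matrix \<open>I - \<beta> u u\<^sup>\<dagger>\<close> is unitary iff \<open>2 Re \<beta> = |\<beta>|\<^sup>2 |u|\<^sup>2\<close> (for \<open>u \<noteq> 0\<close>), and
  \<open>\<beta> = 2 / (|u|\<^sup>2 + \<i> t)\<close> with real \<open>t\<close> solves this equation.  The matrices tend to the identity as
  \<open>t\<close> tends to either infinity, from opposite directions; they serve as the perturbations in the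
  proof of the spectral theorem.
\<close>

lemma quasi_reflection_unitary:
  fixes u :: "complex^'n" and t :: real
  assumes "u \<noteq> 0"
  defines "s \<equiv> (norm u)\<^sup>2"
  defines "\<beta> \<equiv> 2 / Complex s t"
  defines "V \<equiv> \<chi> i j. (if i = j then 1 else 0) - \<beta> * u $ i * cnj (u $ j)"
  shows "unitary_matrix V"
proof -
  have s: "s > 0" using assms by simp
  have entry: "V $ i $ j * z = (if i = j then z else 0) - \<beta> * u $ i * cnj (u $ j) * z"
    "V\<^sup>\<dagger> $ i $ j * z = (if i = j then z else 0) - cnj \<beta> * u $ i * cnj (u $ j) * z" for i j z
    by (simp_all add: V_def algebra_simps)
  have V: "V *v x = x - (\<beta> * cinner u x) *s u"
    and V': "V\<^sup>\<dagger> *v x = x - (cnj \<beta> * cinner u x) *s u" for x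
    unfolding vec_eq_iff matrix_vector_mult_def vec_lambda_beta entry
    by (simp_all add: sum_subtractf cinner_def sum_distrib_left mult_ac)
  have nz: "Complex s t \<noteq> 0" "cnj (Complex s t) \<noteq> 0" using s by (simp_all add: complex_eq_iff)
  have "\<beta> + cnj \<beta> = \<beta> * cnj \<beta> * s"
  proof -
    have "2 / z + 2 / z' = 2 / z * (2 / z') * of_real s"
      if "z + z' = 2 * of_real s" "z \<noteq> 0" "z' \<noteq> 0" for z z' :: complex
    proof -
      have "2 / z + 2 / z' = 2 * (z + z') / (z * z')"
        using that(2,3) by (simp add: field_simps)
      also have "\<dots> = 2 / z * (2 / z') * of_real s"
        unfolding that(1) by simp
      finally show ?thesis .
    qed
    from this[OF _ nz] show ?thesis by (simp add: \<beta>_def complex_eq_iff)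
  qed
  then have "V\<^sup>\<dagger> *v (V *v x) = x" for x
  proof -
    assume b: "\<beta> + cnj \<beta> = \<beta> * cnj \<beta> * s"
    have "V\<^sup>\<dagger> *v (V *v x) = x - ((\<beta> + cnj \<beta> - \<beta> * cnj \<beta> * s) * cinner u x) *s u"
      unfolding V V' cinner_diff_right cinner_scale_right cinner_self s_def
      by (simp add: vec_eq_iff algebra_simps)
    with b show ?thesis by simp
  qed
  then show ?thesis
    unfolding unitary_matrix_def by (simp add: matrix_eq matrix_vector_mul_assoc)
qed

text \<open>
  Let \<open>D\<close> be a real diagonal matrix with distinct entries and let \<open>U\<close> maximize the trace of
  \<open>D U\<^sup>\<dagger> A U\<close> over the compact unitary group.  Multiplying \<open>U\<close> by the unitary matrices
  \<open>I - \<beta> u u\<^sup>\<dagger>\<close> cannot increase the trace, which forces \<open>u\<^sup>\<dagger> D M u\<close> to be real for every \<open>u\<close>, where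
  \<open>M = U\<^sup>\<dagger> A U\<close>.  So \<open>D M\<close> is Hermitian, that is, \<open>M\<close> commutes with \<open>D\<close>, and then \<open>M\<close> is diagonal.
\<close>

lemma spectral_theorem:
  fixes A :: "complex^'n^'n"
  assumes A: "A\<^sup>\<dagger> = A"
  obtains U d where "unitary_matrix U" "A = U ** real_diag d ** U\<^sup>\<dagger>"
proof -
  obtain w :: "'n \<Rightarrow> real" where w: "inj w" using exists_inj_real by blast
  define \<phi> where "\<phi> = (\<lambda>B :: complex^'n^'n. \<Sum>k\<in>UNIV. w k * Re (B $ k $ k))"
  have "continuous_on stiefel (\<lambda>U. \<phi> (U\<^sup>\<dagger> ** A ** U))"
    unfolding \<phi>_def by (intro continuous_intros)
  moreover have "stiefel \<noteq> ({} :: (complex^'n^'n) set)"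
    using unitary_one unitary_matrix_iff_stiefel by blast
  ultimately obtain U :: "complex^'n^'n" where U: "unitary_matrix U"
    and max: "\<And>V. unitary_matrix V \<Longrightarrow> \<phi> (V\<^sup>\<dagger> ** A ** V) \<le> \<phi> (U\<^sup>\<dagger> ** A ** U)"
    using continuous_attains_sup[OF compact_stiefel, of "\<lambda>U. \<phi> (U\<^sup>\<dagger> ** A ** U)"]
    unfolding unitary_matrix_iff_stiefel by blast
  define M where "M = U\<^sup>\<dagger> ** A ** U"
  have M: "M\<^sup>\<dagger> = M" unfolding M_def by (simp add: conj_transpose_mult A matrix_mul_assoc)
  have maxM: "\<phi> (V\<^sup>\<dagger> ** M ** V) \<le> \<phi> M" if "unitary_matrix V" for V
  proof -
    have "unitary_matrix (U ** V)"
      using that U unfolding unitary_matrix_iff_stiefel by (rule stiefel_mult[rotated])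
    from max[OF this] show ?thesis by (simp add: M_def conj_transpose_mult matrix_mul_assoc)
  qed
  have "Im (cinner u ((real_diag w ** M) *v u)) = 0" for u
  proof (cases "u = 0")
    case False
    define s where "s = (norm u)\<^sup>2"
    have s: "s > 0" using False by (simp add: s_def)
    define c where "c = cinner u ((real_diag w ** M) *v u)"
    define q where "q = Re (cinner u (M *v u))"
    define K where "K = q * (\<Sum>k\<in>UNIV. w k * (cmod (u $ k))\<^sup>2)"
    have c_eq: "c = (\<Sum>k\<in>UNIV. of_real (w k) * cnj (u $ k) * (M *v u) $ k)"
      by (simp add: c_def matrix_vector_mul_assoc[symmetric] cinner_def real_diag_vector_mult mult_ac)
    (* Maximality of M against the perturbation with parameter t. It bounds an affine function of t
       from below, so the slope Im c has to vanish. *)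
    have lower: "2 * K \<le> 2 * (s * Re c + t * Im c)" for t
    proof -
      define \<beta> where "\<beta> = 2 / Complex s t"
      define V :: "complex^'n^'n" where "V = (\<chi> i j. (if i = j then 1 else 0) - \<beta> * u $ i * cnj (u $ j))"
      have "unitary_matrix V"
        unfolding V_def \<beta>_def s_def by (rule quasi_reflection_unitary[OF False])
      have Ve: "V *v axis k 1 = axis k 1 - (\<beta> * cnj (u $ k)) *s u" for k
        unfolding vec_eq_iff matrix_vector_axis by (auto simp: V_def axis_def)
      have entry: "Re ((V\<^sup>\<dagger> ** M ** V) $ k $ k) =
          Re (M $ k $ k) - 2 * Re (\<beta> * (cnj (u $ k) * (M *v u) $ k)) + (cmod \<beta>)\<^sup>2 * (cmod (u $ k))\<^sup>2 * q" for k
      proof -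
        have "(V\<^sup>\<dagger> ** M ** V) $ k $ k = cinner (axis k 1) ((V\<^sup>\<dagger> ** M ** V) *v axis k 1)"
          by (simp add: cinner_axis_left matrix_vector_axis)
        also have "\<dots> = cinner (V *v axis k 1) (M *v (V *v axis k 1))"
          by (simp add: matrix_vector_mul_assoc[symmetric] cinner_adjoint)
        also have "\<dots> = M $ k $ k - \<beta> * cnj (u $ k) * (M *v u) $ k
            - cnj \<beta> * u $ k * cinner u (M *v axis k 1)
            + (\<beta> * cnj \<beta>) * (u $ k * cnj (u $ k)) * cinner u (M *v u)"
          unfolding Ve matrix_vector_mult_diff_distrib vec.scale cinner_diff_left cinner_diff_right
            cinner_scale_left cinner_scale_right cinner_axis_left matrix_vector_axis
          by (simp add: algebra_simps)
        finally have *: "(V\<^sup>\<dagger> ** M ** V) $ k $ k = M $ k $ k - \<beta> * cnj (u $ k) * (M *v u) $ k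
            - cnj \<beta> * u $ k * cinner u (M *v axis k 1)
            + (\<beta> * cnj \<beta>) * (u $ k * cnj (u $ k)) * cinner u (M *v u)" .
        have 1: "cinner u (M *v axis k 1) = cnj ((M *v u) $ k)"
          unfolding cinner_adjoint M
          by (simp add: cinner_axis_left flip: cnj_cinner[of "axis k 1" "M *v u"])
        have 2: "cnj \<beta> * u $ k * cnj ((M *v u) $ k) = cnj (\<beta> * (cnj (u $ k) * (M *v u) $ k))"
          by simp
        have 3: "\<beta> * cnj \<beta> * (u $ k * cnj (u $ k)) = of_real ((cmod \<beta>)\<^sup>2 * (cmod (u $ k))\<^sup>2)"
          by (simp only: of_real_mult complex_norm_square)
        show ?thesis
          unfolding * 1 2 3 q_def by (simp del: complex_cnj_mult add: mult.assoc)
      qed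
      have "\<phi> (V\<^sup>\<dagger> ** M ** V) = \<phi> M - 2 * Re (\<beta> * c) + (cmod \<beta>)\<^sup>2 * K"
        unfolding \<phi>_def entry K_def c_eq Re_sum sum_distrib_left
        by (simp add: algebra_simps sum.distrib sum_subtractf sum_distrib_left)
      with maxM[OF \<open>unitary_matrix V\<close>] have le: "(cmod \<beta>)\<^sup>2 * K \<le> 2 * Re (\<beta> * c)" by simp
      have pos: "s\<^sup>2 + t\<^sup>2 > 0" using s by (simp add: add_pos_nonneg)
      have b2: "(cmod \<beta>)\<^sup>2 = 4 / (s\<^sup>2 + t\<^sup>2)"
        by (simp add: \<beta>_def norm_divide power_divide cmod_power2)
      have bc: "Re (\<beta> * c) = 2 * (s * Re c + t * Im c) / (s\<^sup>2 + t\<^sup>2)"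
        using pos by (simp add: \<beta>_def Re_divide field_simps)
      have "(4 * K) / (s\<^sup>2 + t\<^sup>2) \<le> (4 * (s * Re c + t * Im c)) / (s\<^sup>2 + t\<^sup>2)"
        using le unfolding b2 bc by simp
      moreover have "a \<le> b" if "a / n \<le> b / n" "n > 0" for a b n :: real
        using that by (simp add: divide_le_cancel)
      ultimately have "4 * K \<le> 4 * (s * Re c + t * Im c)"
        using pos by blast
      then show ?thesis by simp
    qed
    have "Im c = 0"
    proof (rule ccontr)
      assume nz: "Im c \<noteq> 0"
      from lower[of "(K - 1 - s * Re c) / Im c"] show False
        unfolding nonzero_eq_divide_eq[OF nz, of "(K - 1 - s * Re c) / Im c" "K - 1 - s * Re c", THEN iffD1, OF refl]
        by simp
    qed
    then show ?thesis by (simp add: c_def)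
  qed simp
  then have "(real_diag w ** M)\<^sup>\<dagger> = real_diag w ** M"
    by (rule hermitian_if_real_form)
  then have comm: "M ** real_diag w = real_diag w ** M"
    by (simp add: conj_transpose_mult M)
  have off: "M $ i $ j = 0" if "i \<noteq> j" for i j
  proof -
    have "M $ i $ j * of_real (w j) = of_real (w i) * M $ i $ j"
      unfolding real_diag_mult_right[symmetric] real_diag_mult_left[symmetric] comm ..
    moreover have "w i \<noteq> w j" using w that by (auto simp: inj_def)
    ultimately show ?thesis by auto
  qed
  have "Im (M $ i $ i) = 0" for i
  proof -
    have "M\<^sup>\<dagger> $ i $ i = M $ i $ i" by (simp only: M)
    then show ?thesis by (simp add: complex_eq_iff)
  qed
  with off have "M = real_diag (\<lambda>i. Re (M $ i $ i))"
    by (simp add: vec_eq_iff real_diag_def complex_eq_iff)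
  moreover have "A = U ** M ** U\<^sup>\<dagger>"
  proof -
    have "U ** M ** U\<^sup>\<dagger> = (U ** U\<^sup>\<dagger>) ** A ** (U ** U\<^sup>\<dagger>)"
      unfolding M_def by (simp only: matrix_mul_assoc)
    then show ?thesis by (simp add: unitary_right_inverse[OF U])
  qed
  ultimately have "A = U ** real_diag (\<lambda>i. Re (M $ i $ i)) ** U\<^sup>\<dagger>"
    by simp
  then show ?thesis by (rule that[OF U])
qed

section \<open>Positive definite matrices and their square roots\<close>

lemma
  assumes "invertible A"
  shows matrix_inv_right: "A ** matrix_inv A = mat 1"
    and matrix_inv_left: "matrix_inv A ** A = mat 1"
  using someI_ex[of "\<lambda>A'. A ** A' = mat 1 \<and> A' ** A = mat 1"] assms
  unfolding matrix_inv_def invertible_def by auto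

lemma cinner_real_diag: "cinner x (real_diag d *v x) = complex_of_real (\<Sum>i\<in>UNIV. d i * (cmod (x $ i))\<^sup>2)"
proof -
  have "cnj (x $ i) * (complex_of_real (d i) * x $ i) = complex_of_real (d i * (cmod (x $ i))\<^sup>2)" for i
    by (simp only: of_real_mult complex_norm_square) (simp add: mult_ac)
  then show ?thesis
    by (simp add: cinner_def real_diag_vector_mult del: of_real_mult of_real_power)
qed

lemma cinner_congruence: "cinner x ((B\<^sup>\<dagger> ** A ** B) *v x) = cinner (B *v x) (A *v (B *v x))"
  by (simp add: cinner_adjoint[of x "B\<^sup>\<dagger>"] flip: matrix_vector_mul_assoc)

definition full_rank :: "complex^'r^'m \<Rightarrow> bool" where
  "full_rank z \<longleftrightarrow> (\<forall>x. z *v x = 0 \<longrightarrow> x = 0)"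

lemma full_rank_iff_left_inverse: "full_rank z \<longleftrightarrow> (\<exists>B. B ** z = mat 1)"
  unfolding full_rank_def by (rule matrix_left_invertible_ker[symmetric])

lemma full_rank_square: "full_rank A \<longleftrightarrow> invertible (A :: complex^'n^'n)"
  by (simp add: full_rank_iff_left_inverse invertible_left_inverse)

lemma rank_eq_iff_full_rank: "rank z = CARD('r) \<longleftrightarrow> full_rank (z :: complex^'r^'m)"
proof -
  have "rank z = CARD('r) \<longleftrightarrow> vec.dim (rows z) = vec.dimension TYPE(complex) TYPE('r)"
    using vec_dim_card[where 'a = complex and 'n = 'r]
    by (simp add: row_rank_def_gen vec.dimension_def)
  then show ?thesis
    unfolding vec.dim_eq_full full_rank_iff_left_inverse matrix_left_invertible_span_rows_gen .
qed

lemma full_rank_mult: "full_rank A \<Longrightarrow> full_rank B \<Longrightarrow> full_rank (A ** B)"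
  by (simp add: full_rank_def flip: matrix_vector_mul_assoc)

lemma full_rank_stiefel: "X \<in> stiefel \<Longrightarrow> full_rank X"
  by (auto simp: full_rank_iff_left_inverse stiefel_def)

lemma invertible_hpd:
  assumes "hermitian_pos_def A"
  shows "invertible A"
proof -
  have "x = 0" if "A *v x = 0" for x
    using assms that unfolding hermitian_pos_def_iff by force
  then show ?thesis by (simp add: full_rank_square[symmetric] full_rank_def)
qed

lemma hpd_congruence:
  assumes "hermitian_pos_def A" "full_rank B"
  shows "hermitian_pos_def (B\<^sup>\<dagger> ** A ** B)"
  using assms unfolding hermitian_pos_def_iff cinner_congruence full_rank_def
  by (auto simp: conj_transpose_mult matrix_mul_assoc)

lemma hpd_one: "hermitian_pos_def (mat 1)"
  by (simp add: hermitian_pos_def_iff cinner_self)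

lemma hpd_gram: "full_rank z \<Longrightarrow> hermitian_pos_def (z\<^sup>\<dagger> ** z)"
  using hpd_congruence[OF hpd_one] by simp

text \<open>
  The inverse is the congruence \<open>B\<^sup>\<dagger> A B\<close> of \<open>A\<close> by \<open>B = A\<^sup>-\<^sup>1\<close>, once \<open>B\<close> is known to be Hermitian.
\<close>

lemma hpd_matrix_inv:
  assumes "hermitian_pos_def A"
  shows "hermitian_pos_def (matrix_inv A)"
proof -
  let ?B = "matrix_inv A"
  note inv = matrix_inv_left[OF invertible_hpd[OF assms]] matrix_inv_right[OF invertible_hpd[OF assms]]
  have "A ** ?B\<^sup>\<dagger> = (?B ** A)\<^sup>\<dagger>"
    using assms by (simp add: conj_transpose_mult hermitian_pos_def_iff)
  also have "\<dots> = mat 1" by (simp add: inv)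
  finally have "?B ** (A ** ?B\<^sup>\<dagger>) = ?B" by simp
  then have herm: "?B\<^sup>\<dagger> = ?B" by (simp add: matrix_mul_assoc inv)
  have "invertible ?B" unfolding invertible_def using inv by blast
  then have "hermitian_pos_def (?B\<^sup>\<dagger> ** A ** ?B)"
    by (intro hpd_congruence assms) (simp add: full_rank_square)
  then show ?thesis by (simp add: herm inv)
qed

lemma cinner_unitary_diag:
  assumes U: "unitary_matrix U"
  shows "cinner (U *v axis i 1) ((U ** real_diag d ** U\<^sup>\<dagger>) *v (U *v axis i 1)) = complex_of_real (d i)"
proof -
  have Ux: "U\<^sup>\<dagger> *v (U *v axis i 1) = axis i 1"
    using U by (simp add: matrix_vector_mul_assoc unitary_matrix_def)
  have "cinner (U *v axis i 1) ((U ** real_diag d ** U\<^sup>\<dagger>) *v (U *v axis i 1)) =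
      cinner (axis i 1) (real_diag d *v axis i 1)"
    using cinner_congruence[of "U *v axis i 1" "U\<^sup>\<dagger>" "real_diag d"] unfolding Ux by simp
  then show ?thesis by (simp add: cinner_axis_left matrix_vector_axis real_diag_def)
qed

lemma hpd_spectral:
  assumes "hermitian_pos_def A"
  obtains U d where "unitary_matrix U" "A = U ** real_diag d ** U\<^sup>\<dagger>" "\<And>i. d i > 0"
proof -
  obtain U d where U: "unitary_matrix U" and A: "A = U ** real_diag d ** U\<^sup>\<dagger>"
    using assms spectral_theorem[of A] unfolding hermitian_pos_def_iff by metis
  have "d i > 0" for i
  proof -
    let ?x = "U *v axis i 1"
    have "U\<^sup>\<dagger> *v ?x = axis i 1"
      using U by (simp add: matrix_vector_mul_assoc unitary_matrix_def)
    then have "?x \<noteq> 0" by auto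
    then have "0 < Re (cinner ?x (A *v ?x))"
      using assms by (simp add: hermitian_pos_def_iff)
    then show ?thesis unfolding A cinner_unitary_diag[OF U] by simp
  qed
  with that U A show ?thesis by blast
qed

lemma hpd_unitary_diag:
  fixes U :: "complex^'n^'n"
  assumes "unitary_matrix U" "\<And>i. d i > 0"
  shows "hermitian_pos_def (U ** real_diag d ** U\<^sup>\<dagger>)"
proof -
  have "hermitian_pos_def (real_diag d)"
    unfolding hermitian_pos_def_iff cinner_real_diag
  proof (intro conjI allI impI)
    fix x :: "complex^'n" assume "x \<noteq> 0"
    then obtain i where "x $ i \<noteq> 0" by (auto simp: vec_eq_iff)
    then have "0 < (\<Sum>i\<in>UNIV. d i * (cmod (x $ i))\<^sup>2)"
      using assms(2) by (intro sum_pos2[of _ i]) (auto simp: less_imp_le)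
    then show "0 < Re (complex_of_real (\<Sum>i\<in>UNIV. d i * (cmod (x $ i))\<^sup>2))" by simp
  qed simp
  moreover have "full_rank (U\<^sup>\<dagger>)"
    using unitary_conj_transpose[OF assms(1)] unfolding unitary_matrix_iff_stiefel by (rule full_rank_stiefel)
  ultimately show ?thesis using hpd_congruence[of "real_diag d" "U\<^sup>\<dagger>"] by simp
qed

lemma det_hpd:
  assumes "hermitian_pos_def A"
  shows "det A = complex_of_real (Re (det A))" "Re (det A) > 0"
proof -
  obtain U d where U: "unitary_matrix U" and A: "A = U ** real_diag d ** U\<^sup>\<dagger>" and d: "\<And>i. d i > 0"
    using hpd_spectral[OF assms] by blast
  have "det A = det (real_diag d) * det (U ** U\<^sup>\<dagger>)" by (simp add: A det_mul mult_ac)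
  then have "det A = complex_of_real (\<Prod>i\<in>UNIV. d i)"
    by (simp add: unitary_right_inverse[OF U] det_real_diag)
  then show "det A = complex_of_real (Re (det A))" "Re (det A) > 0"
    using d by (simp_all add: prod_pos flip: of_real_prod)
qed

lemma hpd_sqrt_exists:
  assumes "hermitian_pos_def A"
  shows "\<exists>S. hermitian_pos_def S \<and> S ** S = A"
proof -
  obtain U d where U: "unitary_matrix U" and A: "A = U ** real_diag d ** U\<^sup>\<dagger>" and d: "\<And>i. d i > 0"
    using hpd_spectral[OF assms] by blast
  define S where "S = U ** real_diag (\<lambda>i. sqrt (d i)) ** U\<^sup>\<dagger>"
  have "S ** S = U ** real_diag (\<lambda>i. sqrt (d i)) ** (U\<^sup>\<dagger> ** U) ** real_diag (\<lambda>i. sqrt (d i)) ** U\<^sup>\<dagger>"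
    unfolding S_def by (simp only: matrix_mul_assoc)
  also have "\<dots> = U ** (real_diag (\<lambda>i. sqrt (d i)) ** real_diag (\<lambda>i. sqrt (d i))) ** U\<^sup>\<dagger>"
    using U by (simp add: unitary_matrix_def matrix_mul_assoc)
  also have "\<dots> = A" using d by (simp add: A real_diag_mult_real_diag less_imp_le)
  finally have "S ** S = A" .
  moreover have "hermitian_pos_def S" unfolding S_def by (rule hpd_unitary_diag[OF U]) (simp add: d)
  ultimately show ?thesis by blast
qed

lemma trace_congruence:
  "trace (B\<^sup>\<dagger> ** A ** B) = (\<Sum>k\<in>UNIV. cinner (B *v axis k 1) (A *v (B *v axis k 1)))"
  unfolding trace_def cinner_congruence[symmetric] cinner_axis_left matrix_vector_axis ..

lemma hpd_trace_congruence:
  assumes "hermitian_pos_def A"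
  shows "0 \<le> Re (trace (B\<^sup>\<dagger> ** A ** B))" "Re (trace (B\<^sup>\<dagger> ** A ** B)) = 0 \<Longrightarrow> B = 0"
proof -
  have nonneg: "0 \<le> Re (cinner x (A *v x))" for x
    using assms unfolding hermitian_pos_def_iff by (cases "x = 0") (auto simp: less_imp_le)
  show "0 \<le> Re (trace (B\<^sup>\<dagger> ** A ** B))"
    unfolding trace_congruence Re_sum by (intro sum_nonneg nonneg)
  assume "Re (trace (B\<^sup>\<dagger> ** A ** B)) = 0"
  then have "Re (cinner (B *v axis k 1) (A *v (B *v axis k 1))) = 0" for k
    unfolding trace_congruence Re_sum using nonneg by (subst (asm) sum_nonneg_eq_0_iff) auto
  then have "B *v axis k 1 = 0" for k
    using assms unfolding hermitian_pos_def_iff by force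
  then show "B = 0" by (simp add: vec_eq_iff flip: matrix_vector_axis)
qed

text \<open>
  The difference \<open>D\<close> of two roots satisfies \<open>S D + D T = 0\<close>.  Multiplying by \<open>D\<close> and taking traces
  gives \<open>tr (D S D) + tr (D T D) = 0\<close> with nonnegative summands, and a vanishing \<open>tr (D S D)\<close> forces
  \<open>D = 0\<close> by definiteness of \<open>S\<close>.
\<close>

lemma hpd_sqrt_unique:
  assumes S: "hermitian_pos_def S" and T: "hermitian_pos_def T" and eq: "S ** S = T ** T"
  shows "S = T"
proof -
  define D where "D = S - T"
  have D: "D\<^sup>\<dagger> = D" using S T by (simp add: D_def conj_transpose_diff hermitian_pos_def_iff)
  have "S ** D + D ** T = 0"
    by (simp add: D_def matrix_diff_left matrix_diff_right eq)
  then have "D ** (S ** D + D ** T) = 0"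
    by (metis bounded_bilinear.zero_right bounded_bilinear_matrix_mult)
  then have "D ** S ** D + D ** D ** T = 0"
    by (simp add: matrix_add_ldistrib matrix_mul_assoc)
  then have "trace (D ** S ** D + D ** D ** T) = 0"
    by (simp add: trace_def)
  then have "trace (D ** S ** D) + trace (D ** (D ** T)) = 0"
    by (simp add: trace_add matrix_mul_assoc)
  then have "trace (D\<^sup>\<dagger> ** S ** D) + trace (D\<^sup>\<dagger> ** T ** D) = 0"
    unfolding D trace_mul_sym[of D "D ** T"] .
  then have "Re (trace (D\<^sup>\<dagger> ** S ** D)) + Re (trace (D\<^sup>\<dagger> ** T ** D)) = 0"
    by (metis plus_complex.sel(1) zero_complex.sel(1))
  then have "Re (trace (D\<^sup>\<dagger> ** S ** D)) = 0"
    using hpd_trace_congruence(1)[OF S, of D] hpd_trace_congruence(1)[OF T, of D] by linarith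
  then have "D = 0" by (rule hpd_trace_congruence(2)[OF S])
  then show ?thesis by (simp add: D_def)
qed

lemma hpd_sqrt_eqI: "hermitian_pos_def S \<Longrightarrow> S ** S = A \<Longrightarrow> hpd_sqrt A = S"
  unfolding hpd_sqrt_def by (rule the_equality) (auto intro: hpd_sqrt_unique)

lemma
  assumes "hermitian_pos_def A"
  shows hpd_hpd_sqrt: "hermitian_pos_def (hpd_sqrt A)"
    and hpd_sqrt_mult_self: "hpd_sqrt A ** hpd_sqrt A = A"
proof -
  obtain S where S: "hermitian_pos_def S" "S ** S = A"
    using hpd_sqrt_exists[OF assms] by blast
  then have "hpd_sqrt A = S" by (rule hpd_sqrt_eqI)
  with S show "hermitian_pos_def (hpd_sqrt A)" "hpd_sqrt A ** hpd_sqrt A = A" by simp_all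
qed

section \<open>Polar decomposition\<close>

lemma conj_transpose_hpd: "hermitian_pos_def T \<Longrightarrow> T\<^sup>\<dagger> = T"
  by (simp add: hermitian_pos_def_iff)

text \<open>
  Uniqueness of the polar decomposition: the Gram matrix of \<open>X T\<close> is \<open>T\<^sup>2\<close>, whose root is \<open>T\<close>.
\<close>

lemma orientation_mult_hpd:
  assumes X: "X \<in> stiefel" and T: "hermitian_pos_def T"
  shows "orientation (X ** T) = X"
proof -
  have "full_rank (X ** T)"
    using full_rank_stiefel[OF X] invertible_hpd[OF T] by (simp add: full_rank_mult full_rank_square)
  moreover have "(X ** T)\<^sup>\<dagger> ** (X ** T) = T ** T"
    by (simp add: gram_stiefel_mult[OF X] conj_transpose_hpd[OF T])
  moreover have "X ** T ** matrix_inv T = X"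
    by (simp add: matrix_inv_right[OF invertible_hpd[OF T]] flip: matrix_mul_assoc)
  ultimately show ?thesis
    by (simp add: orientation_def rank_eq_iff_full_rank hpd_sqrt_eqI[OF T])
qed

text \<open>
  For \<open>z\<close> of full column rank this is the root of the Gram matrix of \<open>z\<close>.  Expressing it by the
  orientation lets it inherit measurability from there.
\<close>

definition polar_factor :: "complex^'r^'m \<Rightarrow> complex^'r^'r" where
  "polar_factor z = (orientation z)\<^sup>\<dagger> ** z"

lemma
  fixes z :: "complex^'r^'m"
  assumes "full_rank z"
  shows orientation_stiefel_full_rank: "orientation z \<in> stiefel"
    and polar_decomposition: "orientation z ** polar_factor z = z"
    and hpd_polar_factor: "hermitian_pos_def (polar_factor z)"
proof -
  define T where "T = hpd_sqrt (z\<^sup>\<dagger> ** z)"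
  have T: "hermitian_pos_def T" "T ** T = z\<^sup>\<dagger> ** z"
    using hpd_hpd_sqrt hpd_sqrt_mult_self hpd_gram[OF assms] unfolding T_def by auto
  note inv = matrix_inv_left[OF invertible_hpd[OF T(1)]] matrix_inv_right[OF invertible_hpd[OF T(1)]]
  have o: "orientation z = z ** matrix_inv T"
    using assms by (simp add: orientation_def rank_eq_iff_full_rank T_def)
  have iT: "(matrix_inv T)\<^sup>\<dagger> = matrix_inv T"
    by (rule conj_transpose_hpd[OF hpd_matrix_inv[OF T(1)]])
  have pf: "polar_factor z = T"
  proof -
    have "polar_factor z = matrix_inv T ** (z\<^sup>\<dagger> ** z)"
      unfolding polar_factor_def o conj_transpose_mult iT by (simp only: matrix_mul_assoc)
    also have "\<dots> = T" by (simp add: T(2)[symmetric] matrix_mul_assoc inv)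
    finally show ?thesis .
  qed
  show "hermitian_pos_def (polar_factor z)" by (simp add: pf T)
  show "orientation z ** polar_factor z = z"
    by (simp add: pf o inv flip: matrix_mul_assoc)
  have "(orientation z)\<^sup>\<dagger> ** orientation z = polar_factor z ** matrix_inv T"
    unfolding polar_factor_def unfolding o by (simp only: matrix_mul_assoc)
  then show "orientation z \<in> stiefel" by (simp add: pf inv stiefel_def)
qed

lemma stiefel_nonempty:
  assumes "CARD('r) \<le> CARD('m)"
  shows "(stiefel :: (complex^'r^'m) set) \<noteq> {}"
proof -
  obtain h :: "'r \<Rightarrow> 'm" where h: "inj h"
    using card_le_inj[of "UNIV :: 'r set" "UNIV :: 'm set"] assms by auto
  define X :: "complex^'r^'m" where "X = (\<chi> i j. if i = h j then 1 else 0)"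
  have "X \<in> stiefel"
    using h by (auto simp: stiefel_def X_def vec_eq_iff matrix_matrix_mult_def mat_def inj_eq
        if_distrib if_distribR cong: if_cong)
  then show ?thesis by blast
qed

lemma orientation_stiefel:
  assumes "CARD('r) \<le> CARD('m)"
  shows "orientation (z :: complex^'r^'m) \<in> stiefel"
proof (cases "full_rank z")
  case False
  then show ?thesis
    using someI_ex[of "\<lambda>X :: complex^'r^'m. X \<in> stiefel"] stiefel_nonempty[OF assms]
    by (auto simp: orientation_def rank_eq_iff_full_rank)
qed (rule orientation_stiefel_full_rank)

lemma full_rank_unitary: "unitary_matrix U \<Longrightarrow> full_rank U"
  unfolding unitary_matrix_iff_stiefel by (rule full_rank_stiefel)

text \<open>
  If \<open>z = H T\<close> then \<open>U z Q = (U H Q) (Q\<^sup>\<dagger> T Q)\<close> is again a polar decomposition.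
\<close>

lemma orientation_equivariant:
  assumes z: "full_rank z" and U: "unitary_matrix U" and Q: "unitary_matrix Q"
  shows "orientation (U ** z ** Q) = U ** orientation z ** Q"
proof -
  have "U ** z ** Q = U ** orientation z ** (Q ** Q\<^sup>\<dagger>) ** polar_factor z ** Q"
    by (simp add: unitary_right_inverse[OF Q] polar_decomposition[OF z] flip: matrix_mul_assoc)
  also have "\<dots> = (U ** orientation z ** Q) ** (Q\<^sup>\<dagger> ** polar_factor z ** Q)"
    by (simp only: matrix_mul_assoc)
  finally show ?thesis
    using U Q orientation_stiefel_full_rank[OF z] unfolding unitary_matrix_iff_stiefel
    by (simp add: orientation_mult_hpd stiefel_mult hpd_congruence hpd_polar_factor[OF z]
        full_rank_stiefel)
qed

section \<open>Transitivity of the unitary group on the Stiefel manifold\<close>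

text \<open>
  The determinant is a polynomial in \<open>t\<close>, and it does not vanish identically because \<open>t I + A\<close> is
  injective as soon as \<open>t\<close> exceeds the operator norm of \<open>A\<close>.
\<close>

lemma finite_eigenvalues: "finite {t. det (mat t + A :: complex^'n^'n) = 0}"
proof -
  define p where "p = det (\<chi> i j. [:A $ i $ j, if i = j then 1 else 0:] :: complex poly^'n^'n)"
  have p: "poly p t = det (mat t + A)" for t
    unfolding p_def det_def poly_sum poly_mult poly_prod poly_of_int
    by (intro sum.cong prod.cong arg_cong2[where f = "(*)"] refl) (simp add: mat_def)
  define t where "t = complex_of_real (onorm ((*v) A) + 1)"
  have on: "onorm ((*v) A) \<ge> 0" by (rule onorm_pos_le) simp
  have "x = 0" if "(mat t + A) *v x = 0" for x
  proof -
    have "mat t *v x = t *s x"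
      by (simp add: vec_eq_iff matrix_vector_mult_def mat_def if_distrib if_distribR cong: if_cong)
    also have "\<dots> = (onorm ((*v) A) + 1) *\<^sub>R x"
      unfolding t_def vec_eq_iff vector_smult_component vector_scaleR_component
      by (simp add: scaleR_conv_of_real)
    finally have "A *v x = - ((onorm ((*v) A) + 1) *\<^sub>R x)"
      using that by (simp add: matrix_vector_mult_add_rdistrib eq_neg_iff_add_eq_0 add.commute)
    then have "norm (A *v x) = (onorm ((*v) A) + 1) * norm x"
      using on by (simp only: norm_minus_cancel norm_scaleR)
    moreover have "norm (A *v x) \<le> onorm ((*v) A) * norm x" by (rule onorm) simp
    ultimately show ?thesis by (simp add: algebra_simps)
  qed
  then have "poly p t \<noteq> 0"
    unfolding p invertible_det_nz[symmetric] full_rank_square[symmetric] full_rank_def by blast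
  then have "finite {t. poly p t = 0}" by (intro poly_roots_finite) auto
  then show ?thesis by (simp add: p)
qed

lemma infinite_unit_circle: "infinite {t :: complex. cmod t = 1}"
proof -
  have "inj_on (\<lambda>t. Complex t (sqrt (1 - t\<^sup>2))) {0..1}"
    by (auto simp: inj_on_def)
  then have "infinite ((\<lambda>t. Complex t (sqrt (1 - t\<^sup>2))) ` {0..1})"
    by (simp add: finite_image_iff infinite_Icc)
  moreover have "(\<lambda>t. Complex t (sqrt (1 - t\<^sup>2))) ` {0..1} \<subseteq> {t. cmod t = 1}"
    by (auto simp: cmod_def power_le_one)
  ultimately show ?thesis using finite_subset by blast
qed

lemma matrix_add_right: "(A + B) ** C = A ** C + B ** (C :: complex^'c^'b)"
  using bounded_bilinear.add_left[OF bounded_bilinear_matrix_mult] by auto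

text \<open>
  A block version of the Householder reflection that exchanges two vectors.  With \<open>W = Y - X\<close> and
  \<open>C = I - Y\<^sup>\<dagger> X\<close> the matrix \<open>U = I - W C\<^sup>-\<^sup>1 W\<^sup>\<dagger>\<close> maps \<open>X\<close> to \<open>Y\<close> since \<open>W\<^sup>\<dagger> X = - C\<close>, and it is
  unitary since \<open>W\<^sup>\<dagger> W = C + C\<^sup>\<dagger>\<close>.
\<close>

lemma stiefel_reflection:
  assumes X: "X \<in> stiefel" and Y: "Y \<in> stiefel" and inv: "invertible (mat 1 - Y\<^sup>\<dagger> ** X)"
  shows "\<exists>U. unitary_matrix U \<and> U ** X = Y"
proof -
  define W where "W = Y - X"
  define C where "C = mat 1 - Y\<^sup>\<dagger> ** X"
  define K where "K = matrix_inv C"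
  have CK: "C ** K = mat 1" "K ** C = mat 1"
    unfolding K_def using matrix_inv_right matrix_inv_left inv C_def by auto
  have KC': "K\<^sup>\<dagger> ** C\<^sup>\<dagger> = mat 1" using CK by (metis conj_transpose_mult conj_transpose_one)
  have XY: "X\<^sup>\<dagger> ** X = mat 1" "Y\<^sup>\<dagger> ** Y = mat 1" using X Y by (auto simp: stiefel_def)
  have WX: "W\<^sup>\<dagger> ** X = - C"
    by (simp add: W_def C_def conj_transpose_diff matrix_diff_left XY)
  have WW: "W\<^sup>\<dagger> ** W = C + C\<^sup>\<dagger>"
    by (simp add: W_def C_def conj_transpose_diff conj_transpose_mult matrix_diff_left matrix_diff_right XY)
  define U where "U = mat 1 - W ** K ** W\<^sup>\<dagger>"
  have "U ** X = Y"
  proof -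
    have "U ** X = X - W ** (K ** (W\<^sup>\<dagger> ** X))"
      by (simp add: U_def matrix_diff_left matrix_mul_assoc)
    also have "\<dots> = X + W" 
      unfolding WX bounded_bilinear.minus_right[OF bounded_bilinear_matrix_mult] by (simp add: CK)
    finally show ?thesis by (simp add: W_def)
  qed
  moreover have "unitary_matrix U"
  proof -
    have "U\<^sup>\<dagger> ** U = mat 1 - W ** K ** W\<^sup>\<dagger> - W ** K\<^sup>\<dagger> ** W\<^sup>\<dagger> + W ** (K\<^sup>\<dagger> ** (W\<^sup>\<dagger> ** W) ** K) ** W\<^sup>\<dagger>"
      by (simp add: U_def conj_transpose_diff conj_transpose_mult matrix_diff_left matrix_diff_right matrix_mul_assoc)
    also have "K\<^sup>\<dagger> ** (W\<^sup>\<dagger> ** W) ** K = K\<^sup>\<dagger> + K"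
    proof -
      have "K\<^sup>\<dagger> ** (W\<^sup>\<dagger> ** W) ** K = K\<^sup>\<dagger> ** (C ** K) + (K\<^sup>\<dagger> ** C\<^sup>\<dagger>) ** K"
        unfolding WW by (simp only: matrix_mul_assoc matrix_add_ldistrib matrix_add_right)
      then show ?thesis by (simp add: CK KC')
    qed
    finally show ?thesis
      by (simp add: unitary_matrix_def matrix_add_ldistrib matrix_add_right)
  qed
  ultimately show ?thesis by blast
qed

lemma mat_mult_left: "(mat c ** A) $ i $ j = c * A $ i $ j"
  and mat_mult_right: "(A ** mat c) $ i $ j = A $ i $ j * c"
  for c :: complex
  by (simp_all add: matrix_matrix_mult_def mat_def if_distrib if_distribR cong: if_cong)

text \<open>
  The reflection carries \<open>X\<close> to \<open>c Y\<close> for a scalar \<open>c\<close> of modulus one that is not an eigenvalue of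
  \<open>Y\<^sup>\<dagger> X\<close>; multiplication by the conjugate of \<open>c\<close> then removes the scalar.
\<close>

lemma unitary_transitive_stiefel:
  fixes X Y :: "complex^'r^'m"
  assumes X: "X \<in> stiefel" and Y: "Y \<in> stiefel"
  shows "\<exists>U. unitary_matrix U \<and> U ** X = Y"
proof -
  obtain c where c: "cmod c = 1" and det: "det (mat c + - (Y\<^sup>\<dagger> ** X)) \<noteq> 0"
    using finite_subset[OF _ finite_eigenvalues] infinite_unit_circle by (metis (mono_tags, lifting) mem_Collect_eq subsetI)
  have cc: "c * cnj c = 1" using c by (simp add: complex_norm_square[symmetric])
  have unit: "unitary_matrix (mat c)" "unitary_matrix (mat (cnj c))"
    using cc by (auto simp: unitary_matrix_def vec_eq_iff mat_mult_right mult.commute) (auto simp: mat_def mult.commute)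
  let ?Y = "Y ** mat c"
  have "?Y \<in> stiefel"
    using Y unit(1) unfolding unitary_matrix_iff_stiefel by (rule stiefel_mult)
  moreover have "mat 1 - ?Y\<^sup>\<dagger> ** X = mat (cnj c) ** (mat c + - (Y\<^sup>\<dagger> ** X))"
  proof -
    have "(mat c)\<^sup>\<dagger> = (mat (cnj c) :: complex^'r^'r)"
      by (auto simp: vec_eq_iff mat_def)
    then have "?Y\<^sup>\<dagger> ** X = mat (cnj c) ** (Y\<^sup>\<dagger> ** X)"
      by (simp add: conj_transpose_mult matrix_mul_assoc)
    then show ?thesis using cc
      by (simp add: vec_eq_iff mat_mult_left algebra_simps) (simp add: mat_def mult.commute)
  qed
  ultimately obtain U where U: "unitary_matrix U" "U ** X = ?Y"
    using stiefel_reflection[OF X, of ?Y] det full_rank_unitary[OF unit(2)]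
    by (auto simp: full_rank_square invertible_det_nz det_mul)
  have "(mat (cnj c) ** U) ** X = mat (cnj c) ** ?Y" by (simp add: U(2) flip: matrix_mul_assoc)
  also have "\<dots> = Y" using cc by (simp add: vec_eq_iff mat_mult_left mat_mult_right mult_ac)
  finally show ?thesis
    using unit(2) U(1) stiefel_mult unfolding unitary_matrix_iff_stiefel by blast
qed

section \<open>Lebesgue measure under linear maps of complex matrices\<close>

lemma nn_integral_lborel_translate:
  fixes F :: "'a::euclidean_space \<Rightarrow> ennreal"
  assumes [measurable]: "F \<in> borel_measurable borel"
  shows "(\<integral>\<^sup>+x. F (x + a) \<partial>lborel) = (\<integral>\<^sup>+x. F x \<partial>lborel)"
proof -
  have "lborel = distr lborel borel (\<lambda>x :: 'a. a + x)"
    using lborel_affine[of 1 a] by (simp add: density_1)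
  then have "(\<integral>\<^sup>+x. F x \<partial>lborel) = (\<integral>\<^sup>+x. F x \<partial>distr lborel borel (\<lambda>x :: 'a. a + x))"
    by simp
  also have "\<dots> = (\<integral>\<^sup>+x. F (a + x) \<partial>lborel)" by (rule nn_integral_distr) measurable
  finally show ?thesis by (simp add: add.commute)
qed

lemma emeasure_unit_ball:
  "emeasure lborel (ball (0::'a::euclidean_space) 1) \<noteq> 0"
  "emeasure lborel (ball (0::'a::euclidean_space) 1) \<noteq> \<infinity>"
proof -
  have "unit_ball_vol (real DIM('a)) \<noteq> 0"
    using unit_ball_vol_pos[of "real DIM('a)"] by (metis less_irrefl of_nat_0_le_iff)
  then show "emeasure lborel (ball (0::'a) 1) \<noteq> 0" by (simp add: emeasure_ball)
  show "emeasure lborel (ball (0::'a) 1) \<noteq> \<infinity>"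
    using emeasure_lborel_ball_finite[of "0::'a" 1] by simp
qed

text \<open>
  The image of Lebesgue measure under \<open>L\<close> is translation invariant, and it agrees with Lebesgue
  measure on the unit ball, which \<open>L\<close> preserves.  That two such measures coincide is seen by
  integrating \<open>1\<^sub>A(L x) 1\<^sub>B(L x - y)\<close>, with \<open>B\<close> the unit ball, in both orders: integrating over \<open>y\<close>
  first gives the volume of \<open>B\<close> times the image measure of \<open>A\<close>, and translating \<open>x\<close> for fixed \<open>y\<close>
  turns the same integral into the volume of \<open>B\<close> times the Lebesgue measure of \<open>A\<close>.
\<close>

lemma distr_lborel_linear_isometry:
  fixes L :: "'a::euclidean_space \<Rightarrow> 'a"
  assumes L: "linear L" and norm: "\<And>x. norm (L x) = norm x"
  shows "distr lborel borel L = lborel"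
proof -
  have "inj L" using norm by (metis L linear_injective_0 norm_eq_zero)
  then have "surj L" using L by (simp add: linear_injective_imp_surjective)
  have [measurable]: "L \<in> borel_measurable borel"
    using L by (intro borel_measurable_continuous_onI linear_continuous_on) (simp add: linear_conv_bounded_linear)
  let ?B = "ball (0::'a) 1"
  have B: "emeasure lborel ?B \<noteq> 0" "emeasure lborel ?B \<noteq> \<infinity>"
    by (rule emeasure_unit_ball)+
  have [measurable]: "?B \<in> sets borel" by simp
  have "emeasure (distr lborel borel L) A = emeasure lborel A" if [measurable]: "A \<in> sets borel" for A
  proof -
    have fiber: "(\<integral>\<^sup>+x. indicator A (L x) * indicator ?B (L x - y) \<partial>lborel) =
        (\<integral>\<^sup>+x. indicator A (L x + y) * indicator ?B (L x) \<partial>lborel)" (is "?l = ?r") for y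
    proof -
      obtain a where a: "y = L a" using \<open>surj L\<close> by blast
      have "?l = (\<integral>\<^sup>+x. indicator A (L (x + a)) * indicator ?B (L (x + a) - y) \<partial>lborel)"
        by (rule nn_integral_lborel_translate[symmetric]) measurable
      then show ?thesis by (simp add: linear_add[OF L] a)
    qed
    have "emeasure lborel ?B * emeasure (distr lborel borel L) A =
        (\<integral>\<^sup>+x. emeasure lborel ?B * indicator A (L x) \<partial>lborel)"
      using nn_integral_distr[of L lborel borel "indicator A"] by (simp add: nn_integral_cmult)
    also have "\<dots> = (\<integral>\<^sup>+x. (\<integral>\<^sup>+y. indicator A (L x) * indicator ?B (L x - y) \<partial>lborel) \<partial>lborel)"
    proof (intro nn_integral_cong)
      fix x
      (* The ball is symmetric about the origin. *)
      have "(\<integral>\<^sup>+y. indicator ?B (L x - y) \<partial>lborel) = (\<integral>\<^sup>+y. indicator ?B (y + - L x) \<partial>lborel)"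
        by (intro nn_integral_cong) (simp add: indicator_def dist_norm norm_minus_commute)
      also have "\<dots> = emeasure lborel ?B"
        by (subst nn_integral_lborel_translate) simp_all
      finally show "emeasure lborel ?B * indicator A (L x) =
          (\<integral>\<^sup>+y. indicator A (L x) * indicator ?B (L x - y) \<partial>lborel)"
        by (subst nn_integral_cmult) (simp_all add: mult.commute)
    qed
    also have "\<dots> = (\<integral>\<^sup>+y. (\<integral>\<^sup>+x. indicator A (L x) * indicator ?B (L x - y) \<partial>lborel) \<partial>lborel)"
      by (rule lborel_pair.Fubini') measurable
    also have "\<dots> = (\<integral>\<^sup>+y. (\<integral>\<^sup>+x. indicator A (L x + y) * indicator ?B (L x) \<partial>lborel) \<partial>lborel)"
      by (simp only: fiber)
    also have "\<dots> = (\<integral>\<^sup>+x. (\<integral>\<^sup>+y. indicator A (L x + y) * indicator ?B (L x) \<partial>lborel) \<partial>lborel)"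
      by (rule lborel_pair.Fubini'[symmetric]) measurable
    also have "\<dots> = (\<integral>\<^sup>+x. emeasure lborel A * indicator ?B x \<partial>lborel)"
    proof (intro nn_integral_cong)
      fix x
      have "(\<integral>\<^sup>+y. indicator A (L x + y) \<partial>lborel) = emeasure lborel A"
        using nn_integral_lborel_translate[of "indicator A" "L x"] by (simp add: add.commute)
      then show "(\<integral>\<^sup>+y. indicator A (L x + y) * indicator ?B (L x) \<partial>lborel) = emeasure lborel A * indicator ?B x"
        by (subst nn_integral_multc) (simp_all add: indicator_def norm)
    qed
    also have "\<dots> = emeasure lborel ?B * emeasure lborel A"
      by (simp add: nn_integral_cmult mult.commute)
    finally show ?thesis using B by (simp add: ennreal_mult_cancel_left)
  qed
  then show ?thesis by (intro measure_eqI) simp_all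
qed

lemma nn_integral_lborel_isometry:
  fixes L :: "'a::euclidean_space \<Rightarrow> 'a"
  assumes L: "linear L" and norm: "\<And>x. norm (L x) = norm x" and [measurable]: "F \<in> borel_measurable borel"
  shows "(\<integral>\<^sup>+x. F (L x) \<partial>lborel) = (\<integral>\<^sup>+x. F x \<partial>lborel)"
proof -
  have [measurable]: "L \<in> borel_measurable borel"
    using L by (intro borel_measurable_continuous_onI linear_continuous_on) (simp add: linear_conv_bounded_linear)
  have "(\<integral>\<^sup>+x. F x \<partial>lborel) = (\<integral>\<^sup>+x. F x \<partial>distr lborel borel L)"
    by (simp add: distr_lborel_linear_isometry[OF L norm])
  also have "\<dots> = (\<integral>\<^sup>+x. F (L x) \<partial>lborel)" by (rule nn_integral_distr) measurable
  finally show ?thesis ..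
qed

lemma norm_unitary_mult:
  fixes z :: "complex^'r^'m"
  assumes U: "unitary_matrix U" and Q: "unitary_matrix Q"
  shows "norm (U ** z ** Q) = norm z"
proof -
  have "trace ((U ** z ** Q)\<^sup>\<dagger> ** (U ** z ** Q)) = trace (Q\<^sup>\<dagger> ** (z\<^sup>\<dagger> ** (U\<^sup>\<dagger> ** U) ** z ** Q))"
    by (simp only: conj_transpose_mult matrix_mul_assoc)
  also have "\<dots> = trace (z\<^sup>\<dagger> ** z ** (Q ** Q\<^sup>\<dagger>))"
    unfolding trace_mul_sym[of "Q\<^sup>\<dagger>"] using U by (simp add: unitary_matrix_def flip: matrix_mul_assoc)
  also have "\<dots> = trace (z\<^sup>\<dagger> ** z)" by (simp add: unitary_right_inverse[OF Q])
  finally have "(norm (U ** z ** Q))\<^sup>2 = (norm z)\<^sup>2" by (simp add: norm_conv_trace)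
  then show ?thesis by simp
qed

lemma linear_mult_both: "linear (\<lambda>z :: complex^'r^'m. U ** z ** Q)"
proof -
  have "bounded_linear (\<lambda>z :: complex^'r^'m. U ** z ** Q)"
    using bounded_linear_compose[OF bounded_bilinear.bounded_linear_left[OF bounded_bilinear_matrix_mult]
        bounded_bilinear.bounded_linear_right[OF bounded_bilinear_matrix_mult]] .
  then show ?thesis by (rule bounded_linear.linear)
qed

lemma nn_integral_lborel_unitary:
  fixes F :: "complex^'r^'m \<Rightarrow> ennreal"
  assumes "unitary_matrix U" "unitary_matrix Q" "F \<in> borel_measurable borel"
  shows "(\<integral>\<^sup>+z. F (U ** z ** Q) \<partial>lborel) = (\<integral>\<^sup>+z. F z \<partial>lborel)"
  by (rule nn_integral_lborel_isometry) (use assms in \<open>simp_all add: linear_mult_both norm_unitary_mult\<close>)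

lemma Basis_complex_matrix:
  "(Basis :: (complex^'r^'m) set) = (\<lambda>(i, j, e). axis i (axis j e)) ` (UNIV \<times> UNIV \<times> {1, \<i>})"
  by (auto simp: Basis_vec_def Basis_complex_def image_iff) blast+

text \<open>
  The factors are squared because an entry has two real coordinates.
\<close>

lemma nn_integral_lborel_scale_entries:
  fixes F :: "complex^'r^'m \<Rightarrow> ennreal" and w :: "'m \<Rightarrow> 'r \<Rightarrow> real"
  assumes w: "\<And>i j. w i j > 0" and [measurable]: "F \<in> borel_measurable borel"
  shows "(\<integral>\<^sup>+z. F z \<partial>lborel) = ennreal (\<Prod>i\<in>UNIV. \<Prod>j\<in>UNIV. (w i j)\<^sup>2) *
     (\<integral>\<^sup>+z. F (\<chi> i j. complex_of_real (w i j) * z $ i $ j) \<partial>lborel)"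
proof -
  (* A basis element has a single nonzero entry, of modulus one, so c picks out the weight of that entry. *)
  define c where "c = (\<lambda>b :: complex^'r^'m. \<Sum>i\<in>UNIV. \<Sum>j\<in>UNIV. w i j * cmod (b $ i $ j))"
  define T where "T = (\<lambda>z :: complex^'r^'m. \<chi> i j. complex_of_real (w i j) * z $ i $ j)"
  have c: "c (axis i (axis j e)) = w i j" if "e \<in> {1, \<i>}" for i j e
  proof -
    have "w k l * cmod (axis i (axis j e) $ k $ l) = (if l = j then if k = i then w i j else 0 else 0)" for k l
      using that by (auto simp: axis_def)
    then show ?thesis by (simp add: c_def)
  qed
  have pos: "c b \<noteq> 0" if "b \<in> Basis" for b
  proof -
    obtain i j e where e: "e \<in> {1, \<i>}" "b = axis i (axis j e)"
      using \<open>b \<in> Basis\<close> unfolding Basis_complex_matrix by auto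
    show ?thesis using c[OF e(1), of i j] w[of i j] by (simp add: e(2))
  qed
  have T: "T z = 0 + (\<Sum>b\<in>Basis. (c b * (z \<bullet> b)) *\<^sub>R b)" for z
  proof (rule euclidean_eqI)
    fix b :: "complex^'r^'m" assume b: "b \<in> Basis"
    then obtain i j e where e: "e \<in> {1, \<i>}" "b = axis i (axis j e)"
      unfolding Basis_complex_matrix by auto
    have "T z \<bullet> b = w i j * (z \<bullet> b)"
      using e by (auto simp: T_def inner_axis inner_axis' inner_complex_def)
    then show "T z \<bullet> b = (0 + (\<Sum>b\<in>Basis. (c b * (z \<bullet> b)) *\<^sub>R b)) \<bullet> b"
      using b c[OF e(1)] by (simp add: e(2))
  qed
  have "inj_on (\<lambda>(i, j, e). axis i (axis j e) :: complex^'r^'m) (UNIV \<times> UNIV \<times> {1, \<i>})"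
    by (auto simp: inj_on_def axis_eq_axis)
  then have "(\<Prod>b\<in>Basis. \<bar>c b\<bar>) = (\<Prod>(i, j, e)\<in>UNIV \<times> UNIV \<times> {1, \<i>}. \<bar>c (axis i (axis j e) :: complex^'r^'m)\<bar>)"
    unfolding Basis_complex_matrix by (subst prod.reindex) (auto simp: case_prod_unfold)
  also have "\<dots> = (\<Prod>(i, j, e)\<in>UNIV \<times> UNIV \<times> {1, \<i>}. w i j)"
    using c w by (intro prod.cong) (auto simp: less_imp_le)
  also have "\<dots> = (\<Prod>i\<in>UNIV. \<Prod>j\<in>UNIV. (w i j)\<^sup>2)"
    by (simp add: prod.cartesian_product[symmetric] power2_eq_square)
  finally have prod: "(\<Prod>b\<in>Basis. \<bar>c b\<bar>) = (\<Prod>i\<in>UNIV. \<Prod>j\<in>UNIV. (w i j)\<^sup>2)" .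
  have [measurable]: "T \<in> borel_measurable borel"
    unfolding T_def by (intro borel_measurable_continuous_onI continuous_intros)
  have "lborel = density (distr lborel borel T) (\<lambda>_. ennreal (\<Prod>b\<in>Basis. \<bar>c b\<bar>))"
    using lborel_affine_euclidean[of c 0] pos unfolding T[symmetric] by auto
  then have "(\<integral>\<^sup>+z. F z \<partial>lborel) = (\<integral>\<^sup>+z. F z \<partial>density (distr lborel borel T) (\<lambda>_. ennreal (\<Prod>b\<in>Basis. \<bar>c b\<bar>)))"
    by simp
  also have "\<dots> = ennreal (\<Prod>b\<in>Basis. \<bar>c b\<bar>) * (\<integral>\<^sup>+z. F (T z) \<partial>lborel)"
    by (simp add: nn_integral_density nn_integral_distr nn_integral_cmult)
  finally show ?thesis by (simp add: prod T_def)
qed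

lemma borel_measurable_matrix_mult [measurable]:
  fixes f :: "'a \<Rightarrow> complex^'b^'c" and g :: "'a \<Rightarrow> complex^'d^'b"
  assumes [measurable]: "f \<in> borel_measurable M" "g \<in> borel_measurable M"
  shows "(\<lambda>x. f x ** g x) \<in> borel_measurable M"
  by (rule borel_measurable_continuous_Pair[OF assms]) (intro continuous_intros)

lemma borel_measurable_conj_transpose [measurable]:
  fixes f :: "'a \<Rightarrow> complex^'b^'c"
  assumes [measurable]: "f \<in> borel_measurable M"
  shows "(\<lambda>x. (f x)\<^sup>\<dagger>) \<in> borel_measurable M"
  by (rule borel_measurable_continuous_on[OF _ assms]) (intro continuous_intros)

text \<open>
  Diagonalize \<open>W\<close>.  The unitary factors preserve Lebesgue measure, and the diagonal factor scales
  all \<open>r\<close> entries of a row by one eigenvalue, which gives its power with exponent \<open>2 r\<close>.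
\<close>

lemma nn_integral_lborel_hpd_left:
  fixes F :: "complex^'r^'m \<Rightarrow> ennreal"
  assumes W: "hermitian_pos_def W" and [measurable]: "F \<in> borel_measurable borel"
  shows "(\<integral>\<^sup>+z. F z \<partial>lborel) = ennreal (Re (det W) ^ (2 * CARD('r))) * (\<integral>\<^sup>+z. F (W ** z) \<partial>lborel)"
proof -
  obtain U d where U: "unitary_matrix U" and WU: "W = U ** real_diag d ** U\<^sup>\<dagger>" and d: "\<And>i. d i > 0"
    using hpd_spectral[OF W] by blast
  have "det W = det (real_diag d) * det (U ** U\<^sup>\<dagger>)" by (simp add: WU det_mul mult_ac)
  then have det: "Re (det W) = (\<Prod>i\<in>UNIV. d i)"
    by (simp add: unitary_right_inverse[OF U] det_real_diag del: of_real_prod)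
  have diag: "(\<chi> i j. complex_of_real (d i) * z $ i $ j) = real_diag d ** z" for z :: "complex^'r^'m"
    by (simp add: vec_eq_iff real_diag_mult_left)
  have "(\<integral>\<^sup>+z. F z \<partial>lborel) = (\<integral>\<^sup>+z. F (U ** z) \<partial>lborel)"
    using nn_integral_lborel_unitary[OF U unitary_one, of F] by simp
  also have "\<dots> = ennreal ((\<Prod>i\<in>UNIV. d i) ^ (2 * CARD('r))) * (\<integral>\<^sup>+z. F (U ** (real_diag d ** z)) \<partial>lborel)"
    using nn_integral_lborel_scale_entries[of "\<lambda>i j. d i" "\<lambda>z. F (U ** z)"] d
    by (simp add: diag prod_power_distrib[symmetric] power_mult[symmetric])
  also have "(\<integral>\<^sup>+z. F (U ** (real_diag d ** z)) \<partial>lborel) = (\<integral>\<^sup>+z. F (U ** (real_diag d ** (U\<^sup>\<dagger> ** z))) \<partial>lborel)"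
    using nn_integral_lborel_unitary[OF unitary_conj_transpose[OF U] unitary_one, of "\<lambda>z. F (U ** (real_diag d ** z))"] by simp
  finally show ?thesis unfolding det by (simp add: WU matrix_mul_assoc)
qed

text \<open>
  Here the diagonal factor scales the \<open>m\<close> entries of each column.
\<close>

lemma nn_integral_lborel_hpd_right:
  fixes F :: "complex^'r^'m \<Rightarrow> ennreal"
  assumes S: "hermitian_pos_def S" and [measurable]: "F \<in> borel_measurable borel"
  shows "(\<integral>\<^sup>+z. F z \<partial>lborel) = ennreal (Re (det S) ^ (2 * CARD('m))) * (\<integral>\<^sup>+z. F (z ** S) \<partial>lborel)"
proof -
  obtain U d where U: "unitary_matrix U" and SU: "S = U ** real_diag d ** U\<^sup>\<dagger>" and d: "\<And>i. d i > 0"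
    using hpd_spectral[OF S] by blast
  have "det S = det (real_diag d) * det (U ** U\<^sup>\<dagger>)" by (simp add: SU det_mul mult_ac)
  then have det: "Re (det S) = (\<Prod>i\<in>UNIV. d i)"
    by (simp add: unitary_right_inverse[OF U] det_real_diag del: of_real_prod)
  have diag: "(\<chi> i j. complex_of_real (d j) * z $ i $ j) = z ** real_diag d" for z :: "complex^'r^'m"
    by (simp add: vec_eq_iff real_diag_mult_right mult.commute)
  have "(\<integral>\<^sup>+z. F z \<partial>lborel) = (\<integral>\<^sup>+z. F (z ** U\<^sup>\<dagger>) \<partial>lborel)"
    using nn_integral_lborel_unitary[OF unitary_one unitary_conj_transpose[OF U], of F] by simp
  also have "\<dots> = ennreal ((\<Prod>i\<in>UNIV. d i) ^ (2 * CARD('m))) * (\<integral>\<^sup>+z. F (z ** real_diag d ** U\<^sup>\<dagger>) \<partial>lborel)"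
    using nn_integral_lborel_scale_entries[of "\<lambda>i j. d j" "\<lambda>z. F (z ** U\<^sup>\<dagger>)"] d
    by (simp add: diag prod_power_distrib[symmetric] power_mult[symmetric])
  also have "(\<integral>\<^sup>+z. F (z ** real_diag d ** U\<^sup>\<dagger>) \<partial>lborel) = (\<integral>\<^sup>+z. F (z ** U ** real_diag d ** U\<^sup>\<dagger>) \<partial>lborel)"
    using nn_integral_lborel_unitary[OF unitary_one U, of "\<lambda>z. F (z ** real_diag d ** U\<^sup>\<dagger>)"] by simp
  finally show ?thesis unfolding det by (simp add: SU matrix_mul_assoc)
qed

section \<open>Measurability of the orientation\<close>

lemma full_rank_iff_det: "full_rank z \<longleftrightarrow> det (z\<^sup>\<dagger> ** z) \<noteq> 0"
proof
  assume "full_rank z"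
  then show "det (z\<^sup>\<dagger> ** z) \<noteq> 0"
    using invertible_hpd[OF hpd_gram] by (simp add: invertible_det_nz)
next
  assume "det (z\<^sup>\<dagger> ** z) \<noteq> 0"
  then have "full_rank (z\<^sup>\<dagger> ** z)" by (simp add: full_rank_square invertible_det_nz)
  then show "full_rank z"
    unfolding full_rank_def by (metis matrix_vector_mul_assoc matrix_vector_mult_0_right)
qed

lemma open_full_rank: "open {z :: complex^'r^'m. full_rank z}"
proof -
  have "{z :: complex^'r^'m. full_rank z} = - {z. det (z\<^sup>\<dagger> ** z) = 0}"
    by (auto simp: full_rank_iff_det)
  moreover have "closed {z :: complex^'r^'m. det (z\<^sup>\<dagger> ** z) = 0}"
    by (intro closed_Collect_eq continuous_intros)
  ultimately show ?thesis by auto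
qed

lemma sets_full_rank [measurable]: "{z :: complex^'r^'m. full_rank z} \<in> sets borel"
  using open_full_rank by (rule borel_open)

lemma hpd_if_semidefinite:
  assumes herm: "A\<^sup>\<dagger> = A" and psd: "\<And>x. 0 \<le> Re (cinner x (A *v x))" and "full_rank A"
  shows "hermitian_pos_def A"
proof -
  obtain U d where U: "unitary_matrix U" and A: "A = U ** real_diag d ** U\<^sup>\<dagger>"
    using spectral_theorem[OF herm] by metis
  have ev: "cinner (U *v axis i 1) (A *v (U *v axis i 1)) = d i" for i
    using cinner_unitary_diag[OF U] A by simp
  have "d i > 0" for i
  proof -
    have "det A = det (real_diag d) * det (U ** U\<^sup>\<dagger>)" by (simp add: A det_mul mult_ac)
    then have "det A = complex_of_real (\<Prod>i\<in>UNIV. d i)"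
      by (simp add: unitary_right_inverse[OF U] det_real_diag)
    then have "d i \<noteq> 0"
      using \<open>full_rank A\<close> by (auto simp: full_rank_square invertible_det_nz)
    moreover have "d i \<ge> 0" using psd[of "U *v axis i 1"] by (simp add: ev)
    ultimately show ?thesis by simp
  qed
  then show ?thesis unfolding A by (intro hpd_unitary_diag U)
qed

text \<open>
  The conditions on the right are closed in the pair \<open>(X, z)\<close>.  Semidefiniteness is enough because
  \<open>z\<close>, and with it \<open>X\<^sup>\<dagger> z\<close>, has trivial kernel.
\<close>

lemma orientation_graph:
  assumes z: "full_rank z" and X: "X \<in> stiefel"
  shows "orientation z = X \<longleftrightarrow>
    X ** (X\<^sup>\<dagger> ** z) = z \<and> (X\<^sup>\<dagger> ** z)\<^sup>\<dagger> = X\<^sup>\<dagger> ** z \<and> (\<forall>x. 0 \<le> Re (cinner x ((X\<^sup>\<dagger> ** z) *v x)))"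
    (is "_ \<longleftrightarrow> ?R")
proof
  assume o: "orientation z = X"
  have pf: "X\<^sup>\<dagger> ** z = polar_factor z" by (simp add: o polar_factor_def)
  have "0 \<le> Re (cinner x (polar_factor z *v x))" for x
    using hpd_polar_factor[OF z] unfolding hermitian_pos_def_iff by (cases "x = 0") (auto simp: less_imp_le)
  then show ?R
    using hpd_polar_factor[OF z] polar_decomposition[OF z] by (simp add: pf o hermitian_pos_def_iff)
next
  assume R: ?R
  have "full_rank (X\<^sup>\<dagger> ** z)"
    using R z unfolding full_rank_def by (metis matrix_vector_mul_assoc matrix_vector_mult_0_right)
  then have "hermitian_pos_def (X\<^sup>\<dagger> ** z)" using R by (intro hpd_if_semidefinite) auto
  from orientation_mult_hpd[OF X this] show "orientation z = X" using R by simp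
qed

text \<open>
  On matrices of full column rank the graph of the orientation is closed, and its values lie in the
  compact Stiefel manifold.  Projections along compact sets are closed maps, so preimages of closed
  sets are relatively closed there.  On the remaining matrices the orientation is constant.
\<close>

lemma borel_measurable_orientation:
  assumes "CARD('r) \<le> CARD('m)"
  shows "(orientation :: complex^'r^'m \<Rightarrow> _) \<in> borel_measurable borel"
proof (rule borel_measurableI)
  fix S :: "(complex^'r^'m) set" assume "open S"
  define C where "C = stiefel - S"
  have "compact C" unfolding C_def using compact_stiefel \<open>open S\<close> by (rule compact_diff)
  define G :: "((complex^'r^'m) \<times> (complex^'r^'m)) set" where
    "G = {(X, z). X ** (X\<^sup>\<dagger> ** z) = z \<and> (X\<^sup>\<dagger> ** z)\<^sup>\<dagger> = X\<^sup>\<dagger> ** z \<and> (\<forall>x. 0 \<le> Re (cinner x ((X\<^sup>\<dagger> ** z) *v x)))}"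
  have "closed G"
    unfolding G_def case_prod_unfold cinner_def matrix_vector_mult_def
    by (intro closed_Collect_conj closed_Collect_all closed_Collect_eq closed_Collect_le continuous_intros)
  define D where "D = {z. \<exists>X. X \<in> C \<and> (X, z) \<in> G}"
  have D: "closed D" unfolding D_def by (rule closed_compact_projection[OF \<open>compact C\<close> \<open>closed G\<close>])
  define X0 :: "complex^'r^'m" where "X0 = (SOME X. X \<in> stiefel)"
  have "orientation z \<in> S \<longleftrightarrow> z \<notin> D" if "full_rank z" for z :: "complex^'r^'m"
  proof -
    have "z \<in> D \<longleftrightarrow> (\<exists>X \<in> C. orientation z = X)"
      using orientation_graph[OF that] unfolding D_def G_def C_def by auto
    then show ?thesis using orientation_stiefel[OF assms, of z] by (auto simp: C_def)
  qed
  moreover have "orientation z \<in> S \<longleftrightarrow> X0 \<in> S" if "\<not> full_rank z" for z :: "complex^'r^'m"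
    using that by (simp add: orientation_def rank_eq_iff_full_rank X0_def)
  ultimately have eq: "orientation -` S \<inter> space borel =
      ({z. full_rank z} - D) \<union> (if X0 \<in> S then - {z. full_rank z} else {})"
    by auto
  have "D \<in> sets borel" using D by simp
  then show "orientation -` S \<inter> space borel \<in> sets borel"
    unfolding eq by (auto intro!: sets.Un sets.Diff simp: Compl_eq_Diff_UNIV)
qed

text \<open>
  For a fixed \<open>E\<close> in the Stiefel manifold the determinant of \<open>E\<^sup>\<dagger> (z + t E) = E\<^sup>\<dagger> z + t I\<close> vanishes for
  finitely many \<open>t\<close> only.  So every line in the direction \<open>E\<close> meets the degenerate matrices in a
  finite set, and Fubini's theorem together with translation invariance shows that they form a null
  set.
\<close>

lemma AE_full_rank:
  assumes "CARD('r) \<le> CARD('m)"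
  shows "AE z :: complex^'r^'m in lborel. full_rank z"
proof -
  define N where "N = - {z :: complex^'r^'m. full_rank z}"
  have [measurable]: "N \<in> sets borel" unfolding N_def using open_full_rank by (intro borel_closed) (simp add: closed_def)
  obtain E :: "complex^'r^'m" where E: "E \<in> stiefel" using stiefel_nonempty[OF assms] by blast
  have fiber: "(\<integral>\<^sup>+t. indicator N (z + t *\<^sub>R E) * indicator {0..1} t \<partial>lborel) = 0" for z
  proof -
    have det0: "det (mat (complex_of_real t) + E\<^sup>\<dagger> ** z) = 0" if t: "z + t *\<^sub>R E \<in> N" for t
    proof (rule ccontr)
      assume nz: "det (mat (complex_of_real t) + E\<^sup>\<dagger> ** z) \<noteq> 0"
      have "E\<^sup>\<dagger> ** (z + t *\<^sub>R E) = E\<^sup>\<dagger> ** z + t *\<^sub>R (E\<^sup>\<dagger> ** E)"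
        using bounded_bilinear.add_right[OF bounded_bilinear_matrix_mult]
          bounded_bilinear.scaleR_right[OF bounded_bilinear_matrix_mult] by metis
      also have "\<dots> = mat (complex_of_real t) + E\<^sup>\<dagger> ** z"
        using E by (auto simp: stiefel_def vec_eq_iff mat_def complex_eq_iff)
      finally have "full_rank (E\<^sup>\<dagger> ** (z + t *\<^sub>R E))"
        using nz by (simp add: full_rank_square invertible_det_nz)
      then have "full_rank (z + t *\<^sub>R E)"
        unfolding full_rank_def by (metis matrix_vector_mul_assoc matrix_vector_mult_0_right)
      with t show False by (simp add: N_def)
    qed
    have "finite (complex_of_real -` {t. det (mat t + E\<^sup>\<dagger> ** z) = 0})"
      by (intro finite_vimageI finite_eigenvalues) (simp add: inj_def)
    then have "finite {t :: real. z + t *\<^sub>R E \<in> N}"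
      by (rule finite_subset[rotated]) (auto intro: det0)
    then have "AE t in lborel. z + t *\<^sub>R E \<notin> N"
      by (intro AE_I[of _ _ "{t. z + t *\<^sub>R E \<in> N}"]) (auto intro: finite_imp_closed emeasure_lborel_countable simp: countable_finite)
    then show ?thesis by (subst nn_integral_0_iff_AE) (auto elim: eventually_mono)
  qed
  (* The unit interval of t has measure one, so averaging over it keeps the measure of N. *)
  have "emeasure lborel N = (\<integral>\<^sup>+t. emeasure lborel N * indicator {0..1::real} t \<partial>lborel)"
    by (simp add: nn_integral_cmult)
  also have "\<dots> = (\<integral>\<^sup>+t. (\<integral>\<^sup>+z. indicator N (z + t *\<^sub>R E) * indicator {0..1} t \<partial>lborel) \<partial>lborel)"
    by (intro nn_integral_cong) (simp add: nn_integral_multc nn_integral_lborel_translate)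
  also have "\<dots> = (\<integral>\<^sup>+z. (\<integral>\<^sup>+t. indicator N (z + t *\<^sub>R E) * indicator {0..1} t \<partial>lborel) \<partial>lborel)"
    by (rule lborel_pair.Fubini') measurable
  also have "\<dots> = 0" by (simp add: fiber)
  finally show ?thesis by (intro AE_I[of _ _ N]) (auto simp: N_def)
qed

section \<open>The invariant measure on the Stiefel manifold\<close>

abbreviation stiefel_borel :: "(complex^'r^'m) measure" where
  "stiefel_borel \<equiv> restrict_space borel stiefel"

definition stiefel_invariant :: "(complex^'r^'m) measure \<Rightarrow> bool" where
  "stiefel_invariant \<mu> \<longleftrightarrow> prob_space \<mu> \<and> sets \<mu> = sets stiefel_borel \<and>
     (\<forall>U Q. unitary_matrix U \<longrightarrow> unitary_matrix Q \<longrightarrow> distr \<mu> \<mu> (\<lambda>X. U ** X ** Q) = \<mu>)"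

text \<open>
  The law of the orientation of a uniformly distributed point of the unit ball.  For square matrices
  it is the Haar probability measure of the unitary group.
\<close>

definition uniform_orientation :: "(complex^'r^'m) measure" where
  "uniform_orientation = distr (uniform_measure lborel (ball 0 1)) stiefel_borel orientation"

lemma space_stiefel_borel [simp]: "space stiefel_borel = stiefel"
  by (simp add: space_restrict_space)

lemma measurable_orientation:
  assumes "CARD('r) \<le> CARD('m)"
  shows "(orientation :: complex^'r^'m \<Rightarrow> _) \<in> borel \<rightarrow>\<^sub>M stiefel_borel"
  by (intro measurable_restrict_space2 borel_measurable_orientation assms)
    (simp add: orientation_stiefel[OF assms])

lemma measurable_into_borel:
  "f \<in> M \<rightarrow>\<^sub>M stiefel_borel \<Longrightarrow> f \<in> M \<rightarrow>\<^sub>M borel"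
  by (simp add: measurable_restrict_space2_iff)

lemma measurable_mult_stiefel:
  fixes f :: "'a \<Rightarrow> complex^'b^'c" and g :: "'a \<Rightarrow> complex^'d^'b"
  assumes f: "f \<in> M \<rightarrow>\<^sub>M stiefel_borel" and g: "g \<in> M \<rightarrow>\<^sub>M stiefel_borel"
  shows "(\<lambda>x. f x ** g x) \<in> M \<rightarrow>\<^sub>M stiefel_borel"
proof (rule measurable_restrict_space2)
  show "(\<lambda>x. f x ** g x) \<in> space M \<rightarrow> stiefel"
    using measurable_space[OF f] measurable_space[OF g] by (auto intro: stiefel_mult)
  show "(\<lambda>x. f x ** g x) \<in> M \<rightarrow>\<^sub>M borel"
    using f g by (intro borel_measurable_matrix_mult measurable_into_borel)
qed

lemma measurable_unitary_stiefel:
  assumes "unitary_matrix U" "unitary_matrix Q"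
  shows "(\<lambda>X. U ** X ** Q) \<in> stiefel_borel \<rightarrow>\<^sub>M stiefel_borel"
  using assms unfolding unitary_matrix_iff_stiefel
  by (intro measurable_mult_stiefel measurable_const) auto

lemma nn_integral_stiefel_invariant:
  assumes \<mu>: "stiefel_invariant \<mu>" and U: "unitary_matrix U" and Q: "unitary_matrix Q"
    and F: "F \<in> borel_measurable stiefel_borel"
  shows "(\<integral>\<^sup>+X. F (U ** X ** Q) \<partial>\<mu>) = (\<integral>\<^sup>+X. F X \<partial>\<mu>)"
proof -
  have sets[measurable_cong]: "sets \<mu> = sets stiefel_borel" using \<mu> by (simp add: stiefel_invariant_def)
  have "(\<integral>\<^sup>+X. F X \<partial>\<mu>) = (\<integral>\<^sup>+X. F X \<partial>distr \<mu> \<mu> (\<lambda>X. U ** X ** Q))"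
    using \<mu> U Q by (simp add: stiefel_invariant_def)
  also have "\<dots> = (\<integral>\<^sup>+X. F (U ** X ** Q) \<partial>\<mu>)"
    using F measurable_unitary_stiefel[OF U Q]
    by (intro nn_integral_distr) (simp_all cong: measurable_cong_sets add: sets)
  finally show ?thesis ..
qed

text \<open>
  The unit ball and Lebesgue measure are invariant under \<open>z \<mapsto> U z Q\<close>, and the orientation commutes
  with this map.
\<close>

lemma stiefel_invariant_uniform_orientation:
  assumes "CARD('r) \<le> CARD('m)"
  shows "stiefel_invariant (uniform_orientation :: (complex^'r^'m) measure)"
proof -
  let ?B = "ball (0 :: complex^'r^'m) 1"
  let ?\<mu> = "uniform_orientation :: (complex^'r^'m) measure"
  note o [measurable] = measurable_orientation[OF assms]
  have B: "emeasure lborel ?B \<noteq> 0" "emeasure lborel ?B \<noteq> \<infinity>"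
    by (rule emeasure_unit_ball)+
  have [measurable]: "?B \<in> sets borel" by simp
  have o': "orientation \<in> uniform_measure lborel ?B \<rightarrow>\<^sub>M stiefel_borel"
    using o by (simp cong: measurable_cong_sets)
  have int: "(\<integral>\<^sup>+X. F X \<partial>?\<mu>) = (\<integral>\<^sup>+z. F (orientation z) * indicator ?B z \<partial>lborel) / emeasure lborel ?B"
    if [measurable]: "F \<in> borel_measurable stiefel_borel" for F
  proof -
    have "(\<lambda>z. F (orientation z)) \<in> borel_measurable borel" by measurable
    then show ?thesis
      unfolding uniform_orientation_def using o' that
      by (subst nn_integral_distr) (auto simp: nn_integral_uniform_measure B)
  qed
  have sets: "sets ?\<mu> = sets stiefel_borel" by (simp add: uniform_orientation_def)
  have "prob_space ?\<mu>"
    unfolding uniform_orientation_def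
    by (intro prob_space.prob_space_distr prob_space_uniform_measure o' B)
  moreover have "distr ?\<mu> ?\<mu> (\<lambda>X. U ** X ** Q) = ?\<mu>"
    if U: "unitary_matrix U" and Q: "unitary_matrix Q" for U Q
  proof (rule measure_eqI)
    fix A assume "A \<in> sets (distr ?\<mu> ?\<mu> (\<lambda>X. U ** X ** Q))"
    then have A [measurable]: "A \<in> sets stiefel_borel" by (simp add: sets)
    note T [measurable] = measurable_unitary_stiefel[OF U Q]
    have "(\<integral>\<^sup>+z. indicator A (U ** orientation z ** Q) * indicator ?B z \<partial>lborel)
        = (\<integral>\<^sup>+z. indicator A (orientation (U ** z ** Q)) * indicator ?B (U ** z ** Q) \<partial>lborel)"
      using AE_full_rank[OF assms]
      by (intro nn_integral_cong_AE, elim eventually_mono)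
        (simp add: orientation_equivariant U Q norm_unitary_mult indicator_def)
    also have "\<dots> = (\<integral>\<^sup>+z. indicator A (orientation z) * indicator ?B z \<partial>lborel)"
      by (rule nn_integral_lborel_unitary[OF U Q]) measurable
    finally have "(\<integral>\<^sup>+X. indicator A (U ** X ** Q) \<partial>?\<mu>) = (\<integral>\<^sup>+X. indicator A X \<partial>?\<mu>)"
      by (simp add: int)
    moreover have "(\<integral>\<^sup>+X. indicator A (U ** X ** Q) \<partial>?\<mu>) = emeasure (distr ?\<mu> ?\<mu> (\<lambda>X. U ** X ** Q)) A"
      using T A by (subst nn_integral_distr[symmetric, where f = "indicator A" and M' = ?\<mu>])
        (simp_all add: sets cong: measurable_cong_sets)
    ultimately show "emeasure (distr ?\<mu> ?\<mu> (\<lambda>X. U ** X ** Q)) A = emeasure ?\<mu> A"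
      using A by (simp add: sets)
  qed simp
  ultimately show ?thesis using sets unfolding stiefel_invariant_def by blast
qed

text \<open>
  Averaging \<open>F\<close> over the unitary orbit of \<open>X\<^sub>0\<close> gives a value that is independent of \<open>X\<^sub>0\<close>, by
  transitivity and right invariance of the Haar measure.  Integrating this constant over \<open>\<mu>\<close> and
  exchanging the integrals identifies it with the integral of \<open>F\<close>.
\<close>

lemma stiefel_average:
  fixes F :: "complex^'r^'m \<Rightarrow> ennreal"
  assumes \<mu>: "stiefel_invariant \<mu>" and F [measurable]: "F \<in> borel_measurable stiefel_borel"
    and X0: "X0 \<in> stiefel"
  shows "(\<integral>\<^sup>+U. F (U ** X0) \<partial>(uniform_orientation :: (complex^'m^'m) measure)) = (\<integral>\<^sup>+X. F X \<partial>\<mu>)"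
proof -
  let ?\<nu> = "uniform_orientation :: (complex^'m^'m) measure"
  have \<nu>: "stiefel_invariant ?\<nu>" by (rule stiefel_invariant_uniform_orientation) simp
  have sets [measurable_cong]: "sets \<mu> = sets stiefel_borel" "sets ?\<nu> = sets stiefel_borel"
    using \<mu> \<nu> by (simp_all add: stiefel_invariant_def)
  have space: "space \<mu> = stiefel" "space ?\<nu> = stiefel" 
    using sets_eq_imp_space_eq[OF sets(1)] sets_eq_imp_space_eq[OF sets(2)] by simp_all
  interpret \<mu>: prob_space \<mu> using \<mu> by (simp add: stiefel_invariant_def)
  interpret \<nu>: prob_space ?\<nu> using \<nu> by (simp add: stiefel_invariant_def)
  interpret pair_sigma_finite ?\<nu> \<mu> ..
  define G where "G = (\<lambda>X. \<integral>\<^sup>+U. F (U ** X) \<partial>?\<nu>)"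
  have const: "G X = G X0" if X: "X \<in> stiefel" for X
  proof -
    obtain V where V: "unitary_matrix V" "V ** X0 = X"
      using unitary_transitive_stiefel[OF X0 X] by blast
    have "(\<lambda>U. F (U ** X0)) \<in> borel_measurable stiefel_borel"
      by (rule measurable_compose[OF measurable_mult_stiefel F]) (use X0 in simp_all)
    from nn_integral_stiefel_invariant[OF \<nu> unitary_one V(1) this] show ?thesis
      by (simp add: G_def V(2) flip: matrix_mul_assoc)
  qed
  have "(\<integral>\<^sup>+X. F X \<partial>\<mu>) = (\<integral>\<^sup>+U. (\<integral>\<^sup>+X. F X \<partial>\<mu>) \<partial>?\<nu>)"
    by (simp add: \<nu>.emeasure_space_1)
  also have "\<dots> = (\<integral>\<^sup>+U. (\<integral>\<^sup>+X. F (U ** X) \<partial>\<mu>) \<partial>?\<nu>)"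
  proof (rule nn_integral_cong)
    fix U assume "U \<in> space ?\<nu>"
    then have "unitary_matrix U" by (simp add: space unitary_matrix_iff_stiefel)
    from nn_integral_stiefel_invariant[OF \<mu> this unitary_one F]
    show "(\<integral>\<^sup>+X. F X \<partial>\<mu>) = (\<integral>\<^sup>+X. F (U ** X) \<partial>\<mu>)" by simp
  qed
  also have "\<dots> = (\<integral>\<^sup>+X. G X \<partial>\<mu>)"
    unfolding G_def
  proof (rule Fubini'[symmetric])
    have "(\<lambda>(U, X). U ** X) \<in> ?\<nu> \<Otimes>\<^sub>M \<mu> \<rightarrow>\<^sub>M stiefel_borel"
      unfolding case_prod_unfold by (intro measurable_mult_stiefel) measurable
    from measurable_compose[OF this F]
    show "(\<lambda>(U, X). F (U ** X)) \<in> borel_measurable (?\<nu> \<Otimes>\<^sub>M \<mu>)"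
      by (simp add: case_prod_unfold)
  qed
  also have "\<dots> = (\<integral>\<^sup>+X. G X0 \<partial>\<mu>)"
    by (intro nn_integral_cong const) (simp add: space)
  finally show ?thesis by (simp add: \<mu>.emeasure_space_1 G_def)
qed

text \<open>
  The left side of the averaging identity does not mention the measure \<open>\<mu>\<close>.
\<close>

lemma stiefel_invariant_unique:
  fixes \<mu> \<mu>' :: "(complex^'r^'m) measure"
  assumes "CARD('r) \<le> CARD('m)" "stiefel_invariant \<mu>" "stiefel_invariant \<mu>'"
  shows "\<mu> = \<mu>'"
proof (rule measure_eqI)
  have sets: "sets \<mu> = sets stiefel_borel" "sets \<mu>' = sets stiefel_borel"
    using assms by (simp_all add: stiefel_invariant_def)
  then show "sets \<mu> = sets \<mu>'" by simp
  obtain X0 :: "complex^'r^'m" where X0: "X0 \<in> stiefel" using stiefel_nonempty[OF assms(1)] by blast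
  fix A assume "A \<in> sets \<mu>"
  then have A: "A \<in> sets stiefel_borel" by (simp add: sets)
  have "(\<integral>\<^sup>+X. indicator A X \<partial>\<mu>) = (\<integral>\<^sup>+X. indicator A X \<partial>\<mu>')"
    using stiefel_average[OF assms(2) _ X0, of "indicator A"] stiefel_average[OF assms(3) _ X0, of "indicator A"] A
    by simp
  then show "emeasure \<mu> A = emeasure \<mu>' A" using A by (simp add: sets)
qed

text \<open>
  Existence and uniqueness give the definite description its meaning.
\<close>

lemma stiefel_invariant_stiefel_measure:
  assumes "CARD('r) \<le> CARD('m)"
  shows "stiefel_invariant (stiefel_measure :: (complex^'r^'m) measure)"
proof -
  have "stiefel_measure = (THE \<mu> :: (complex^'r^'m) measure. stiefel_invariant \<mu>)"
    by (simp add: stiefel_measure_def stiefel_invariant_def)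
  also have "stiefel_invariant \<dots>"
    by (rule theI) (use assms in \<open>auto intro: stiefel_invariant_uniform_orientation stiefel_invariant_unique\<close>)
  finally show ?thesis .
qed

text \<open>
  Polar coordinates without a Jacobian.  By left invariance of Lebesgue measure \<open>F z\<close> may be replaced
  under the integral by its average over the matrices \<open>U z = (U H) T\<close>, where \<open>z = H T\<close> is the polar decomposition and
  \<open>U\<close> is Haar distributed; then \<open>U H\<close> is distributed according to the invariant measure.
\<close>

lemma nn_integral_polar:
  fixes F :: "complex^'r^'m \<Rightarrow> ennreal"
  assumes rm: "CARD('r) \<le> CARD('m)" and F [measurable]: "F \<in> borel_measurable borel"
  shows "(\<integral>\<^sup>+z. F z \<partial>lborel) =
    (\<integral>\<^sup>+H. (\<integral>\<^sup>+z. F (H ** polar_factor (z :: complex^'r^'m)) \<partial>lborel) \<partial>stiefel_measure)"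
proof -
  let ?\<nu> = "uniform_orientation :: (complex^'m^'m) measure"
  let ?\<sigma> = "stiefel_measure :: (complex^'r^'m) measure"
  have \<nu>: "stiefel_invariant ?\<nu>" by (rule stiefel_invariant_uniform_orientation) simp
  have \<sigma>: "stiefel_invariant ?\<sigma>" by (rule stiefel_invariant_stiefel_measure[OF rm])
  have sets [measurable_cong]: "sets ?\<sigma> = sets stiefel_borel" "sets ?\<nu> = sets stiefel_borel"
    using \<sigma> \<nu> by (simp_all add: stiefel_invariant_def)
  have space: "space ?\<sigma> = stiefel" "space ?\<nu> = stiefel" 
    using sets_eq_imp_space_eq[OF sets(1)] sets_eq_imp_space_eq[OF sets(2)] by simp_all
  interpret \<sigma>: prob_space ?\<sigma> using \<sigma> by (simp add: stiefel_invariant_def)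
  interpret \<nu>: prob_space ?\<nu> using \<nu> by (simp add: stiefel_invariant_def)
  interpret N: pair_sigma_finite ?\<nu> "lborel :: (complex^'r^'m) measure" ..
  interpret S: pair_sigma_finite ?\<sigma> "lborel :: (complex^'r^'m) measure" ..
  note [measurable] = borel_measurable_orientation[OF rm]
  have [measurable]: "(polar_factor :: complex^'r^'m \<Rightarrow> _) \<in> borel_measurable borel"
    unfolding polar_factor_def by measurable
  have incl [measurable]: "(\<lambda>H. H) \<in> ?\<sigma> \<rightarrow>\<^sub>M borel" "(\<lambda>U. U) \<in> ?\<nu> \<rightarrow>\<^sub>M borel"
    by (rule measurable_into_borel, measurable)+
  have "(\<integral>\<^sup>+z. F z \<partial>lborel) = (\<integral>\<^sup>+U. (\<integral>\<^sup>+z. F z \<partial>lborel) \<partial>?\<nu>)"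
    by (simp add: \<nu>.emeasure_space_1)
  also have "\<dots> = (\<integral>\<^sup>+U. (\<integral>\<^sup>+z. F (U ** z) \<partial>lborel) \<partial>?\<nu>)"
  proof (rule nn_integral_cong)
    fix U assume "U \<in> space ?\<nu>"
    then have "unitary_matrix U" by (simp add: space unitary_matrix_iff_stiefel)
    from nn_integral_lborel_unitary[OF this unitary_one F]
    show "(\<integral>\<^sup>+z. F z \<partial>lborel) = (\<integral>\<^sup>+z. F (U ** z) \<partial>lborel)" by simp
  qed
  also have "\<dots> = (\<integral>\<^sup>+z. (\<integral>\<^sup>+U. F (U ** z) \<partial>?\<nu>) \<partial>lborel)"
    by (rule N.Fubini'[symmetric]) measurable
  also have "\<dots> = (\<integral>\<^sup>+z. (\<integral>\<^sup>+H. F (H ** polar_factor (z :: complex^'r^'m)) \<partial>?\<sigma>) \<partial>lborel)"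
  proof (rule nn_integral_cong_AE, rule eventually_mono[OF AE_full_rank[OF rm]])
    fix z :: "complex^'r^'m" assume z: "full_rank z"
    have "(\<lambda>H. F (H ** polar_factor z)) \<in> borel_measurable stiefel_borel"
      by (intro measurable_compose[OF _ F] borel_measurable_matrix_mult measurable_const measurable_into_borel) auto
    from stiefel_average[OF \<sigma> this orientation_stiefel[OF rm, of z]]
    show "(\<integral>\<^sup>+U. F (U ** z) \<partial>?\<nu>) = (\<integral>\<^sup>+H. F (H ** polar_factor z) \<partial>?\<sigma>)"
      by (simp add: polar_decomposition[OF z] flip: matrix_mul_assoc)
  qed
  also have "\<dots> = (\<integral>\<^sup>+H. (\<integral>\<^sup>+z. F (H ** polar_factor (z :: complex^'r^'m)) \<partial>lborel) \<partial>?\<sigma>)"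
    by (rule S.Fubini') measurable
  finally show ?thesis .
qed

section \<open>The density of the orientation\<close>

lemma matrix_inv_eqI:
  assumes "A ** B = mat 1"
  shows "matrix_inv A = (B :: complex^'n^'n)"
proof -
  have "invertible A" using assms invertible_right_inverse by blast
  then have "matrix_inv A = matrix_inv A ** (A ** B)" by (simp add: assms)
  also have "\<dots> = B" by (simp add: matrix_mul_assoc matrix_inv_left[OF \<open>invertible A\<close>])
  finally show ?thesis .
qed

lemma Re_det_hpd_square:
  assumes "hermitian_pos_def S"
  shows "Re (det (S ** S)) = (Re (det S))\<^sup>2"
  using det_hpd(1)[OF assms] by (metis Re_complex_of_real det_mul of_real_mult power2_eq_square)

text \<open>
  With \<open>W = B\<^sup>-\<^sup>1\<close>, \<open>W H = X S\<close> and \<open>z = Y T\<close> polar decompositions, and \<open>N = S T\<close>, the form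
  \<open>y \<mapsto> (W y)\<^sup>\<dagger> (W y)\<close> takes the value \<open>N\<^sup>\<dagger> N\<close> at \<open>H T\<close> and \<open>N N\<^sup>\<dagger>\<close> at \<open>B z S\<close>.  The polar
  decomposition \<open>N = Q R\<close> links the two: the values are \<open>R\<^sup>2\<close> and \<open>Q R\<^sup>2 Q\<^sup>\<dagger>\<close>, which are also the
  values at \<open>B H R\<close> and \<open>B H R Q\<^sup>\<dagger>\<close>, and \<open>f\<close> does not distinguish these two points.
\<close>

lemma fiber_invariance:
  fixes f :: "complex^'r^'m \<Rightarrow> 'b"
  assumes B: "hermitian_pos_def B"
    and f: "\<And>y z. y\<^sup>\<dagger> ** matrix_inv (B ** B) ** y = z\<^sup>\<dagger> ** matrix_inv (B ** B) ** z \<Longrightarrow> f y = f z"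
    and inv: "\<And>z Q. unitary_matrix Q \<Longrightarrow> f (z ** Q) = f z"
    and H: "H \<in> stiefel" and z: "full_rank z"
  shows "f (H ** polar_factor z) = f (B ** z ** polar_factor (matrix_inv B ** H))"
proof -
  define W where "W = matrix_inv B"
  have W: "hermitian_pos_def W" unfolding W_def by (rule hpd_matrix_inv[OF B])
  have WB: "W ** B = mat 1" "B ** W = mat 1"
    unfolding W_def using matrix_inv_left matrix_inv_right invertible_hpd[OF B] by auto
  have "(B ** B) ** (W ** W) = B ** (B ** W) ** W" by (simp only: matrix_mul_assoc)
  then have invBB: "matrix_inv (B ** B) = W ** W" by (intro matrix_inv_eqI) (simp add: WB)
  have f_gram: "f y = f y'" if "(W ** y)\<^sup>\<dagger> ** (W ** y) = (W ** y')\<^sup>\<dagger> ** (W ** y')" for y y'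
    using that by (intro f) (simp add: invBB conj_transpose_mult conj_transpose_hpd[OF W] matrix_mul_assoc)
  define S where "S = polar_factor (W ** H)"
  define X where "X = orientation (W ** H)"
  have "full_rank (W ** H)"
    using invertible_hpd[OF W] full_rank_stiefel[OF H] by (simp add: full_rank_mult full_rank_square)
  then have X: "X \<in> stiefel" and S: "hermitian_pos_def S" and XS: "W ** H = X ** S"
    unfolding X_def S_def by (simp_all add: orientation_stiefel_full_rank hpd_polar_factor polar_decomposition)
  define T where "T = polar_factor z"
  define Y where "Y = orientation z"
  have Y: "Y \<in> stiefel" and T: "hermitian_pos_def T" and YT: "z = Y ** T"
    using z unfolding Y_def T_def by (simp_all add: orientation_stiefel_full_rank hpd_polar_factor polar_decomposition)
  define Q where "Q = orientation (S ** T)"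
  define R where "R = polar_factor (S ** T)"
  have "full_rank (S ** T)"
    using invertible_hpd[OF S] invertible_hpd[OF T] by (simp add: full_rank_square invertible_mult)
  then have Q: "Q \<in> stiefel" and R: "hermitian_pos_def R" and QR: "S ** T = Q ** R"
    unfolding Q_def R_def by (simp_all add: orientation_stiefel_full_rank hpd_polar_factor polar_decomposition)
  have Q': "unitary_matrix (Q\<^sup>\<dagger>)" using Q unitary_conj_transpose by (simp add: unitary_matrix_iff_stiefel)
  have cancel: "W ** (B ** A) = A" for A :: "complex^'r^'m" by (simp add: matrix_mul_assoc WB)
  have "f (H ** T) = f (B ** (H ** R))"
  proof (rule f_gram)
    have "W ** (H ** T) = X ** (Q ** R)"
      by (simp add: matrix_mul_assoc XS) (simp add: QR flip: matrix_mul_assoc)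
    then show "(W ** (H ** T))\<^sup>\<dagger> ** (W ** (H ** T)) = (W ** (B ** (H ** R)))\<^sup>\<dagger> ** (W ** (B ** (H ** R)))"
      by (simp add: cancel gram_stiefel_mult X Q H)
  qed
  also have "\<dots> = f (B ** (H ** R) ** Q\<^sup>\<dagger>)" by (rule inv[OF Q', symmetric])
  also have "\<dots> = f (B ** (H ** (Q ** R)\<^sup>\<dagger>))"
    by (simp add: conj_transpose_mult conj_transpose_hpd[OF R] matrix_mul_assoc)
  also have "\<dots> = f (B ** (z ** S))"
  proof (rule f_gram)
    have "(Q ** R)\<^sup>\<dagger> = T ** S"
      unfolding QR[symmetric] by (simp add: conj_transpose_mult conj_transpose_hpd[OF S] conj_transpose_hpd[OF T])
    moreover have "z ** S = Y ** (T ** S)" by (simp add: YT flip: matrix_mul_assoc)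
    ultimately show "(W ** (B ** (H ** (Q ** R)\<^sup>\<dagger>)))\<^sup>\<dagger> ** (W ** (B ** (H ** (Q ** R)\<^sup>\<dagger>))) =
        (W ** (B ** (z ** S)))\<^sup>\<dagger> ** (W ** (B ** (z ** S)))"
      by (simp only: cancel gram_stiefel_mult H Y)
  qed
  finally show ?thesis by (simp add: T_def S_def W_def matrix_mul_assoc)
qed

text \<open>
  By the preceding lemma the integral is that of \<open>f (B z S)\<close>.  Here \<open>B\<^sup>2 = P\<close> and
  \<open>S\<^sup>2 = H\<^sup>\<dagger> P\<^sup>-\<^sup>1 H\<close>, so the volume factors of the substitutions \<open>z \<mapsto> B z\<close> and \<open>z \<mapsto> z S\<close> are the
  two determinant powers in the CMACG density.
\<close>

lemma nn_integral_fiber: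
  fixes f :: "complex^'r^'m \<Rightarrow> ennreal"
  assumes rm: "CARD('r) \<le> CARD('m)" and P: "hermitian_pos_def P"
    and f: "\<And>y z. y\<^sup>\<dagger> ** matrix_inv P ** y = z\<^sup>\<dagger> ** matrix_inv P ** z \<Longrightarrow> f y = f z"
    and inv: "\<And>z Q. unitary_matrix Q \<Longrightarrow> f (z ** Q) = f z"
    and [measurable]: "f \<in> borel_measurable borel"
    and H: "H \<in> stiefel"
  shows "(\<integral>\<^sup>+z. f (H ** polar_factor (z :: complex^'r^'m)) \<partial>lborel) =
    ennreal (cmacg_density P H) * (\<integral>\<^sup>+z. f z \<partial>lborel)"
proof -
  define B where "B = hpd_sqrt P"
  have B: "hermitian_pos_def B" and BB: "B ** B = P"
    unfolding B_def by (simp_all add: hpd_hpd_sqrt hpd_sqrt_mult_self P)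
  define W where "W = matrix_inv B"
  have W: "hermitian_pos_def W" unfolding W_def by (rule hpd_matrix_inv[OF B])
  have WB: "W ** B = mat 1" "B ** W = mat 1"
    unfolding W_def using matrix_inv_left matrix_inv_right invertible_hpd[OF B] by auto
  have "(B ** B) ** (W ** W) = B ** (B ** W) ** W" by (simp only: matrix_mul_assoc)
  then have invP: "matrix_inv P = W ** W" unfolding BB[symmetric] by (intro matrix_inv_eqI) (simp add: WB)
  define S where "S = polar_factor (W ** H)"
  define X where "X = orientation (W ** H)"
  have "full_rank (W ** H)"
    using invertible_hpd[OF W] full_rank_stiefel[OF H] by (simp add: full_rank_mult full_rank_square)
  then have X: "X \<in> stiefel" and S: "hermitian_pos_def S" and XS: "W ** H = X ** S"
    unfolding X_def S_def by (simp_all add: orientation_stiefel_full_rank hpd_polar_factor polar_decomposition)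
  have "H\<^sup>\<dagger> ** matrix_inv P ** H = (W ** H)\<^sup>\<dagger> ** (W ** H)"
    by (simp add: invP conj_transpose_mult conj_transpose_hpd[OF W] matrix_mul_assoc)
  also have "\<dots> = S ** S" by (simp add: XS gram_stiefel_mult[OF X] conj_transpose_hpd[OF S])
  finally have HPH: "H\<^sup>\<dagger> ** matrix_inv P ** H = S ** S" .
  define a where "a = Re (det B) ^ (2 * CARD('r))"
  define b where "b = Re (det S) ^ (2 * CARD('m))"
  have pos: "a > 0" "b > 0" using det_hpd(2)[OF B] det_hpd(2)[OF S] by (simp_all add: a_def b_def)
  have "Re (det P) = (Re (det B))\<^sup>2"
    using Re_det_hpd_square[OF B] by (simp add: BB)
  then have dens: "cmacg_density P H = inverse a * inverse b"
    unfolding cmacg_density_def HPH Re_det_hpd_square[OF S] by (simp add: a_def b_def power_mult)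
  have "(\<integral>\<^sup>+z. f (H ** polar_factor (z :: complex^'r^'m)) \<partial>lborel) = (\<integral>\<^sup>+z. f (B ** z ** S) \<partial>lborel)"
  proof (rule nn_integral_cong_AE, rule eventually_mono[OF AE_full_rank[OF rm]])
    fix z :: "complex^'r^'m" assume z: "full_rank z"
    show "f (H ** polar_factor z) = f (B ** z ** S)"
      unfolding S_def W_def by (rule fiber_invariance[OF B f[folded BB] inv H z])
  qed
  moreover have "(\<integral>\<^sup>+z. f z \<partial>lborel) = ennreal (a * b) * (\<integral>\<^sup>+z. f (B ** z ** S) \<partial>lborel)"
    using nn_integral_lborel_hpd_left[OF B, of f] nn_integral_lborel_hpd_right[OF S, of "\<lambda>z. f (B ** z)"] pos
    by (simp add: a_def b_def matrix_mul_assoc ennreal_mult mult.assoc)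
  moreover have "ennreal (inverse a * inverse b) * ennreal (a * b) = 1"
    using pos by (simp add: field_simps flip: ennreal_mult)
  ultimately show ?thesis by (simp add: dens flip: mult.assoc)
qed

theorem theorem6:
  fixes M :: "'a measure"
    and Z :: "'a \<Rightarrow> complex^'r^'m"
    and P :: "complex^'m^'m"
    and f :: "complex^'r^'m \<Rightarrow> real"
    and g :: "complex^'r^'r \<Rightarrow> real"
  assumes "CARD('r) \<le> CARD('m)"
    and "hermitian_pos_def P"
    and "prob_space M"
    and "distributed M lborel Z (\<lambda>z. ennreal (f z))"
    and "\<And>z. 0 \<le> f z"
    and "\<And>z. f z = inverse (Re (det P) ^ CARD('r)) * g (conj_transpose z ** matrix_inv P ** z)"
    and "\<And>z Q. unitary_matrix Q \<Longrightarrow> f (z ** Q) = f z"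
  shows "has_CMACG M (\<lambda>\<omega>. orientation (Z \<omega>)) P"
proof -
  let ?\<sigma> = "stiefel_measure :: (complex^'r^'m) measure"
  let ?F = "\<lambda>z. ennreal (f z)"
  note rm = assms(1)
  interpret M: prob_space M by fact
  have sets [measurable_cong]: "sets ?\<sigma> = sets stiefel_borel"
    using stiefel_invariant_stiefel_measure[OF rm] by (simp add: stiefel_invariant_def)
  have space: "space ?\<sigma> = stiefel" using sets_eq_imp_space_eq[OF sets] by simp
  interpret \<sigma>: prob_space ?\<sigma>
    using stiefel_invariant_stiefel_measure[OF rm] by (simp add: stiefel_invariant_def)
  note measurable_orientation[OF rm, measurable] borel_measurable_orientation[OF rm, measurable]
  have Z [measurable]: "Z \<in> M \<rightarrow>\<^sub>M borel" and F [measurable]: "?F \<in> borel_measurable borel"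
    and law: "distr M lborel Z = density lborel ?F"
    using assms(4) by (simp_all add: distributed_def)
  have total: "(\<integral>\<^sup>+z. ?F z \<partial>lborel) = 1"
  proof -
    have "(\<integral>\<^sup>+z. ?F z \<partial>lborel) = emeasure (distr M lborel Z) UNIV"
      unfolding law by (simp add: emeasure_density)
    also have "\<dots> = 1" by (simp add: emeasure_distr M.emeasure_space_1)
    finally show ?thesis .
  qed
  have fiber: "(\<integral>\<^sup>+z. ?F (H ** polar_factor (z :: complex^'r^'m)) \<partial>lborel) = ennreal (cmacg_density P H)"
    if "H \<in> stiefel" for H
  proof -
    have 1: "?F y = ?F z" if "y\<^sup>\<dagger> ** matrix_inv P ** y = z\<^sup>\<dagger> ** matrix_inv P ** z" for y z
      unfolding assms(6) that ..
    have 2: "?F (z ** Q) = ?F z" if "unitary_matrix Q" for z Q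
      unfolding assms(7)[OF that] ..
    have "(\<integral>\<^sup>+z. ?F (H ** polar_factor (z :: complex^'r^'m)) \<partial>lborel) =
        ennreal (cmacg_density P H) * (\<integral>\<^sup>+z. ?F z \<partial>lborel)"
      by (rule nn_integral_fiber[OF rm assms(2) 1 2 F that])
    then show ?thesis unfolding total by simp
  qed
  have cont: "continuous_on UNIV (\<lambda>X :: complex^'r^'m. Re (det (X\<^sup>\<dagger> ** matrix_inv P ** X)))"
    by (intro continuous_intros)
  have [measurable]: "(\<lambda>X :: complex^'r^'m. Re (det (X\<^sup>\<dagger> ** matrix_inv P ** X))) \<in> borel_measurable borel"
    by (rule borel_measurable_continuous_onI[OF cont])
  have "(\<lambda>X :: complex^'r^'m. ennreal (cmacg_density P X)) \<in> borel_measurable borel"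
    unfolding cmacg_density_def by measurable
  then have dens [measurable]: "(\<lambda>X :: complex^'r^'m. ennreal (cmacg_density P X)) \<in> borel_measurable ?\<sigma>"
    by (simp add: measurable_restrict_space1 cong: measurable_cong_sets[OF sets refl])
  have oZ [measurable]: "(\<lambda>\<omega>. orientation (Z \<omega>)) \<in> M \<rightarrow>\<^sub>M ?\<sigma>"
    by measurable
  have [measurable]: "(polar_factor :: complex^'r^'m \<Rightarrow> _) \<in> borel_measurable borel"
    unfolding polar_factor_def by measurable
  have "distr M ?\<sigma> (\<lambda>\<omega>. orientation (Z \<omega>)) = density ?\<sigma> (\<lambda>X. ennreal (cmacg_density P X))"
  proof (rule measure_eqI)
    fix A assume "A \<in> sets (distr M ?\<sigma> (\<lambda>\<omega>. orientation (Z \<omega>)))"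
    then have A [measurable]: "A \<in> sets ?\<sigma>" and A' [measurable]: "A \<in> sets stiefel_borel"
      by (simp_all add: sets)
    have [measurable]: "(\<lambda>z. indicator A (orientation z) :: ennreal) \<in> borel_measurable borel"
      by (rule measurable_compose[OF measurable_orientation[OF rm]]) measurable
    have "emeasure (distr M ?\<sigma> (\<lambda>\<omega>. orientation (Z \<omega>))) A = (\<integral>\<^sup>+\<omega>. indicator A (orientation (Z \<omega>)) \<partial>M)"
      using nn_integral_distr[OF oZ, of "indicator A"] by simp
    also have "\<dots> = (\<integral>\<^sup>+z. indicator A (orientation z) \<partial>distr M lborel Z)"
      by (simp add: nn_integral_distr)
    also have "\<dots> = (\<integral>\<^sup>+z. ?F z * indicator A (orientation z) \<partial>lborel)"
      unfolding law by (simp add: nn_integral_density)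
    also have "\<dots> = (\<integral>\<^sup>+H. (\<integral>\<^sup>+z. ?F (H ** polar_factor (z :: complex^'r^'m)) *
        indicator A (orientation (H ** polar_factor z)) \<partial>lborel) \<partial>?\<sigma>)"
      by (rule nn_integral_polar[OF rm]) measurable
    also have "\<dots> = (\<integral>\<^sup>+H. ennreal (cmacg_density P H) * indicator A H \<partial>?\<sigma>)"
    proof (rule nn_integral_cong)
      fix H assume "H \<in> space ?\<sigma>"
      then have H: "H \<in> stiefel" by (simp add: space)
      have "(\<integral>\<^sup>+z. ?F (H ** polar_factor (z :: complex^'r^'m)) *
          indicator A (orientation (H ** polar_factor z)) \<partial>lborel) =
        (\<integral>\<^sup>+z. ?F (H ** polar_factor (z :: complex^'r^'m)) * indicator A H \<partial>lborel)"
        by (rule nn_integral_cong_AE, rule eventually_mono[OF AE_full_rank[OF rm]])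
          (simp add: orientation_mult_hpd[OF H hpd_polar_factor])
      also have "\<dots> = ennreal (cmacg_density P H) * indicator A H"
        by (simp add: nn_integral_multc fiber[OF H])
      finally show "(\<integral>\<^sup>+z. ?F (H ** polar_factor (z :: complex^'r^'m)) *
          indicator A (orientation (H ** polar_factor z)) \<partial>lborel) =
        ennreal (cmacg_density P H) * indicator A H" .
    qed
    also have "\<dots> = emeasure (density ?\<sigma> (\<lambda>X. ennreal (cmacg_density P X))) A"
      by (simp add: emeasure_density)
    finally show "emeasure (distr M ?\<sigma> (\<lambda>\<omega>. orientation (Z \<omega>))) A =
        emeasure (density ?\<sigma> (\<lambda>X. ennreal (cmacg_density P X))) A" .
  qed simp
  then show ?thesis unfolding has_CMACG_def distributed_def using dens oZ by simp
qed

end
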